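(* Let $d\in\mathbb{N}$, let $\{\mu_n\}_{n\in\mathbb{N}},\{\nu_n\}_{n\in\mathbb{N}}$ be sequences of Borel probability measures on $\mathbb{R}^d$, and let $\xi$ be a Borel probability measure on $\mathbb{R}^d$ whose characteristic function vanishes nowhere. Then $$\|\mu_n*\xi-\nu_n*\xi\|_{\mathrm{BL}}\xrightarrow{n\to\infty}0\quad\text{if and only if}\quad\|\mu_n-\nu_n\|_{\mathrm{BL}}\xrightarrow{n\to\infty}0.$$
   Context: $\|\mu-\nu\|_{\mathrm{BL}}=\sup|\int f\,d\mu-\int f\,d\nu|$, the supremum being over all $f:\mathbb{R}^d\to\mathbb{R}$ with $\|f\|_\infty\le1$ and Lipschitz constant at most $1$. $*$ denotes convolution of measures. *)

theory Defs
  imports "HOL-Probability.Probability"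
begin

definition borel_prob :: "'a::topological_space measure \<Rightarrow> bool" where
  "borel_prob M \<longleftrightarrow> prob_space M \<and> sets M = sets borel"

definition bl_unit_ball :: "('a::metric_space \<Rightarrow> real) set" where
  "bl_unit_ball = {f. (\<forall>x. \<bar>f x\<bar> \<le> 1) \<and> 1-lipschitz_on UNIV f}"

(* The supremum is taken in the reals, so it is meaningful only when the set is
   bounded above; see bdd_above_bl_dist below for probability measures. *)
definition bl_dist :: "'a::metric_space measure \<Rightarrow> 'a measure \<Rightarrow> real" where
  "bl_dist M N = (SUP f\<in>bl_unit_ball. \<bar>(LINT x|M. f x) - (LINT x|N. f x)\<bar>)"

definition char_fun :: "'a::euclidean_space measure \<Rightarrow> 'a \<Rightarrow> complex" where
  "char_fun M t = (CLINT x|M. iexp (t \<bullet> x))"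

lemma char_fun_real: "char_fun (M :: real measure) = char M"
  by (simp add: fun_eq_iff char_fun_def char_def)

lemma bl_unit_ball_nonempty: "bl_unit_ball \<noteq> {}"
proof -
  have "(\<lambda>x. 0) \<in> bl_unit_ball"
    by (auto simp: bl_unit_ball_def lipschitz_on_def)
  then show ?thesis by blast
qed

lemma bl_unit_ball_measurable:
  assumes "f \<in> bl_unit_ball"
  shows "f \<in> borel_measurable borel"
  using assms lipschitz_on_continuous_on
  by (auto simp: bl_unit_ball_def intro!: borel_measurable_continuous_onI)

lemma bl_unit_ball_integral_bound:
  assumes "borel_prob M" "f \<in> bl_unit_ball"
  shows "integrable M f" "\<bar>LINT x|M. f x\<bar> \<le> 1"
proof -
  interpret prob_space M using assms(1) by (simp add: borel_prob_def)
  have f: "f \<in> borel_measurable M"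
    using bl_unit_ball_measurable[OF assms(2)] assms(1)
    by (simp add: borel_prob_def cong: measurable_cong_sets)
  have b: "\<bar>f x\<bar> \<le> 1" for x using assms(2) by (simp add: bl_unit_ball_def)
  show i: "integrable M f"
    by (rule integrable_const_bound[of _ 1]) (use f b in auto)
  have "\<bar>LINT x|M. f x\<bar> \<le> (LINT x|M. \<bar>f x\<bar>)"
    by (rule integral_abs_bound)
  also have "\<dots> \<le> (LINT x|M. 1)"
    by (rule integral_mono) (use i b in auto)
  finally show "\<bar>LINT x|M. f x\<bar> \<le> 1" by (simp add: prob_space)
qed

lemma bdd_above_bl_dist:
  assumes "borel_prob M" "borel_prob N"
  shows "bdd_above ((\<lambda>f. \<bar>(LINT x|M. f x) - (LINT x|N. f x)\<bar>) ` bl_unit_ball)"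
proof (rule bdd_aboveI2)
  fix f :: "'a \<Rightarrow> real" assume "f \<in> bl_unit_ball"
  then show "\<bar>(LINT x|M. f x) - (LINT x|N. f x)\<bar> \<le> 2"
    using bl_unit_ball_integral_bound(2)[OF assms(1)] bl_unit_ball_integral_bound(2)[OF assms(2)]
    by fastforce
qed

end

(*
One direction holds because convolution with xi maps the bounded Lipschitz unit ball into itself.

For the other direction no tightness is available, so the continuity theorem does not apply.
For f in the unit ball let phi x = int f (x + y) d(mu - nu)(y), a bounded Lipschitz function
whose average against xi is uniformly at most the distance of the convolutions. It is enough to
show that |phi 0| >= eps bounds the sup of this average from below by a constant depending only
on eps and xi. Smoothing phi with Fejer kernels of width 1/N moves it by at most eps/2. The
Fejer kernel has a triangle as its Fourier transform, and a wide triangle is a combination of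
three triangles of half the width, so repeated halving in each coordinate finds a frequency t in
a fixed box such that the part psi of phi with frequencies near t still satisfies
|psi 0| >= const. By a Bernstein estimate psi (x + y) is close to exp(i t.y) psi x relative to
sup |psi|, hence the average of psi against xi is close to char_fun xi t * psi. As char_fun xi
is bounded away from 0 on the box, the average of psi, and with it that of phi, is not small.
*)
theory Submission
  imports Defs
begin

section \<open>Fejer and de la Vallee-Poussin kernels\<close>

text \<open>Only \<open>fejer_mass > 0\<close> is needed, never its value \<open>pi\<close>. At \<open>s = 0\<close> the kernels take
  the junk value \<open>0\<close> instead of their limit, which is why the identities below hold for
  \<open>s \<noteq> 0\<close> or almost everywhere.\<close>

definition fejer_mass :: real where
  "fejer_mass = (LINT s|lborel. (1 - cos s) / s\<^sup>2)"

text \<open>For \<open>a > 0\<close> this is the Fejer kernel of mass one; its Fourier transform is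
  the triangle max(0, 1 - |t| / a).\<close>

definition fejer :: "real \<Rightarrow> real \<Rightarrow> real" where
  "fejer a s = (1 - cos (a * s)) / (fejer_mass * a * s\<^sup>2)"

text \<open>On the Fourier side, twice the triangle on [-2a, 2a] minus the triangle on
  [-a, a].\<close>

definition vallee_poussin :: "real \<Rightarrow> real \<Rightarrow> real" where
  "vallee_poussin a s = 2 * fejer (2 * a) s - fejer a s"

section \<open>Elementary bounds and normalization of the kernels\<close>

lemma one_minus_cos_bounds:
  fixes s :: real
  shows "0 \<le> 1 - cos s" "1 - cos s \<le> 2" "1 - cos s \<le> s\<^sup>2 / 2"
proof -
  show "0 \<le> 1 - cos s" "1 - cos s \<le> 2"
    using cos_ge_minus_one[of s] by auto
  have "1 - cos s = 2 * (sin (s/2))\<^sup>2"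
    using cos_double_sin[of "s/2"] by simp
  also have "\<dots> \<le> 2 * (s/2)\<^sup>2"
    using abs_le_square_iff[of "sin (s/2)" "s/2"] abs_sin_x_le_abs_x[of "s/2"] by simp
  finally show "1 - cos s \<le> s\<^sup>2 / 2"
    by (simp add: power2_eq_square)
qed

lemma integrable_inverse_one_plus_square:
  "integrable lborel (\<lambda>x::real. inverse (1 + x\<^sup>2))"
  using integrable_inverse_1_plus_square
  by (simp add: set_integrable_def einterval_def)

text \<open>The quadratic bound handles the origin and the bound 2 handles infinity; their sum, with
  5/2 = 1/2 + 2, gives one integrable majorant.\<close>

lemma fejer_shape_le:
  fixes s :: real
  shows "(1 - cos s) / s\<^sup>2 \<le> (5/2) * inverse (1 + s\<^sup>2)"
proof (cases "s = 0")
  case False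
  have "(1 - cos s) * (1 + s\<^sup>2) = (1 - cos s) + (1 - cos s) * s\<^sup>2"
    by (simp add: algebra_simps)
  also have "\<dots> \<le> s\<^sup>2 / 2 + 2 * s\<^sup>2"
    by (intro add_mono mult_right_mono one_minus_cos_bounds) auto
  finally have "(1 - cos s) * (1 + s\<^sup>2) \<le> (5/2) * s\<^sup>2" by simp
  moreover have "0 < 1 + s\<^sup>2" by (simp add: add_pos_nonneg)
  ultimately show ?thesis
    using False by (simp add: field_simps)
qed auto

lemma integrable_fejer_shape: "integrable lborel (\<lambda>s::real. (1 - cos s) / s\<^sup>2)"
proof (rule Bochner_Integration.integrable_bound)
  show "integrable lborel (\<lambda>s::real. (5/2) * inverse (1 + s\<^sup>2))"
    using integrable_inverse_one_plus_square by simp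
  show "AE s::real in lborel. norm ((1 - cos s) / s\<^sup>2) \<le> norm ((5/2) * inverse (1 + s\<^sup>2))"
  proof (rule AE_I2)
    fix s :: real
    have "0 \<le> (1 - cos s) / s\<^sup>2" using one_minus_cos_bounds(1)[of s] by simp
    moreover have "0 \<le> (5/2) * inverse (1 + s\<^sup>2)" by simp
    ultimately show "norm ((1 - cos s) / s\<^sup>2) \<le> norm ((5/2) * inverse (1 + s\<^sup>2))"
      using fejer_shape_le[of s] by simp
  qed
qed measurable

lemma fejer_mass_pos: "fejer_mass > 0"
proof -
  \<comment> \<open>On [1, 2] the integrand is at least (1 - cos 1) / 4, because cos decreases on
    [0, pi] and s^2 is at most 4 there.\<close>
  have "(LINT s|lborel. indicator {1..2::real} s * ((1 - cos 1) / 4 :: real)) \<le> fejer_mass"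
    unfolding fejer_mass_def
  proof (rule integral_mono)
    show "integrable lborel (\<lambda>s::real. indicator {1..2} s * ((1 - cos 1) / 4 :: real))" by simp
    fix s :: real
    have nn: "0 \<le> (1 - cos s) / s\<^sup>2" using one_minus_cos_bounds(1)[of s] by simp
    show "indicator {1..2} s * ((1 - cos 1) / 4) \<le> (1 - cos s) / s\<^sup>2"
    proof (cases "s \<in> {1..2}")
      case True
      have "cos s \<le> cos 1"
        using True pi_ge_two by (intro cos_monotone_0_pi_le) auto
      moreover have "s\<^sup>2 \<le> 4"
        using True power_mono[of s 2 2] by simp
      ultimately have "(1 - cos 1) / 4 \<le> (1 - cos s) / s\<^sup>2"
        using True one_minus_cos_bounds(1)[of s] by (intro frac_le) auto
      then show ?thesis using True by simp
    qed (use nn in simp)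
  qed (rule integrable_fejer_shape)
  moreover have "cos (1::real) < 1"
    using cos_monotone_0_pi[of 0 1] pi_gt3 by simp
  ultimately show ?thesis by simp
qed

lemma integrable_fejer_shape_scaled:
  "integrable lborel (\<lambda>s::real. (1 - cos (a * s)) / s\<^sup>2)"
proof (cases "a = 0")
  case False
  have "integrable lborel (\<lambda>s::real. a\<^sup>2 * ((1 - cos (0 + a * s)) / (0 + a * s)\<^sup>2))"
    by (rule integrable_mult_right, rule lborel_integrable_real_affine[OF integrable_fejer_shape False])
  moreover have "(\<lambda>s::real. a\<^sup>2 * ((1 - cos (0 + a * s)) / (0 + a * s)\<^sup>2)) = (\<lambda>s. (1 - cos (a * s)) / s\<^sup>2)"
    using False by (auto simp: fun_eq_iff power_mult_distrib)
  ultimately show ?thesis by simp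
qed simp

text \<open>A dilation produces the factor |a|. These absolute values are what makes the cosine
  transform of the kernels piecewise linear.\<close>

lemma integral_fejer_shape_scaled:
  "(LINT s|lborel. (1 - cos (a * s)) / s\<^sup>2) = fejer_mass * \<bar>a\<bar>"
proof (cases "a = 0")
  case False
  have "fejer_mass = \<bar>a\<bar> *\<^sub>R (LINT s|lborel. (1 - cos (0 + a * s)) / (0 + a * s)\<^sup>2)"
    unfolding fejer_mass_def by (rule lborel_integral_real_affine[OF False])
  also have "\<dots> = \<bar>a\<bar> * (LINT s|lborel. (1 / a\<^sup>2) * ((1 - cos (a * s)) / s\<^sup>2))"
    by (simp add: power_mult_distrib)
  also have "\<dots> = \<bar>a\<bar> / a\<^sup>2 * (LINT s|lborel. (1 - cos (a * s)) / s\<^sup>2)"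
    by (simp only: integral_mult_right_zero) simp
  finally have "(LINT s|lborel. (1 - cos (a * s)) / s\<^sup>2) = fejer_mass * (a\<^sup>2 / \<bar>a\<bar>)"
    using False by (simp add: field_simps)
  also have "a\<^sup>2 / \<bar>a\<bar> = \<bar>a\<bar>"
    using False by (simp add: power2_eq_square divide_simps flip: abs_mult)
  finally show ?thesis .
qed simp

lemma fejer_measurable [measurable]: "fejer a \<in> borel_measurable borel"
  unfolding fejer_def by measurable

lemma vallee_poussin_measurable [measurable]: "vallee_poussin a \<in> borel_measurable borel"
  unfolding vallee_poussin_def by measurable

lemma integrable_fejer [simp]: "integrable lborel (fejer a)"
proof -
  have "fejer a = (\<lambda>s. inverse (fejer_mass * a) * ((1 - cos (a * s)) / s\<^sup>2))"
    by (simp add: fejer_def fun_eq_iff field_simps)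
  then show ?thesis using integrable_fejer_shape_scaled[of a] by (simp only: integrable_mult_right)
qed

lemma integrable_vallee_poussin [simp]: "integrable lborel (vallee_poussin a)"
  unfolding vallee_poussin_def by simp

lemma fejer_nonneg: "0 < a \<Longrightarrow> 0 \<le> fejer a s"
  unfolding fejer_def using one_minus_cos_bounds(1)[of "a * s"] fejer_mass_pos by simp

lemma integral_fejer: "0 < a \<Longrightarrow> (LINT s|lborel. fejer a s) = 1"
proof -
  assume a: "0 < a"
  have "fejer a = (\<lambda>s. inverse (fejer_mass * a) * ((1 - cos (a * s)) / s\<^sup>2))"
    by (simp add: fejer_def fun_eq_iff field_simps)
  then have "(LINT s|lborel. fejer a s) = inverse (fejer_mass * a) * (fejer_mass * \<bar>a\<bar>)"
    by (simp only: integral_mult_right_zero integral_fejer_shape_scaled)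
  then show ?thesis using a fejer_mass_pos by (simp add: field_simps)
qed

lemma fejer_scale: "a \<noteq> 0 \<Longrightarrow> fejer a s = a * fejer 1 (a * s)"
  by (simp add: fejer_def power2_eq_square)

lemma vallee_poussin_scale: "a \<noteq> 0 \<Longrightarrow> vallee_poussin a s = a * vallee_poussin 1 (a * s)"
  using fejer_scale[of a s] fejer_scale[of "2 * a" s] fejer_scale[of 2 "a * s"]
  by (simp add: vallee_poussin_def right_diff_distrib mult_ac)

lemma vallee_poussin_minus [simp]: "vallee_poussin a (- s) = vallee_poussin a s"
  by (simp add: vallee_poussin_def fejer_def)

section \<open>Fourier transforms of the kernels and the reproducing identity\<close>

lemma integrable_mult_bounded:
  fixes f g :: "'b \<Rightarrow> 'c::{real_normed_field,banach,second_countable_topology}"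
  assumes "integrable M f" and [measurable]: "g \<in> borel_measurable M"
    and "\<And>x. norm (g x) \<le> B"
  shows "integrable M (\<lambda>x. g x * f x)"
proof (rule Bochner_Integration.integrable_bound)
  show "integrable M (\<lambda>x. B * norm (f x))" using assms(1) by simp
  have [measurable]: "f \<in> borel_measurable M" using assms(1) by simp
  show "(\<lambda>x. g x * f x) \<in> borel_measurable M" by measurable
  have "norm (g x * f x) \<le> norm (B * norm (f x))" for x
  proof -
    have "norm (g x * f x) \<le> B * norm (f x)"
      unfolding norm_mult by (intro mult_right_mono assms) auto
    also have "\<dots> \<le> norm (B * norm (f x))" by simp
    finally show ?thesis .
  qed
  then show "AE x in M. norm (g x * f x) \<le> norm (B * norm (f x))" by simp
qed

text \<open>The Fourier transform of the de la Vallee-Poussin kernel is a trapezoid that equals 1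
  on \<open>[-a, a]\<close>, where the transform of the Fejer kernel lives. Convolution with it
  therefore reproduces the Fejer kernel.\<close>

lemma vallee_poussin_cos_transform:
  assumes a: "0 < a" and t: "\<bar>t\<bar> \<le> a"
  shows "(LINT r|lborel. cos (t * r) * vallee_poussin a r) = 1"
proof -
  let ?k = "\<lambda>b r::real. (1 - cos (b * r)) / r\<^sup>2"
  \<comment> \<open>The product formula for cosines splits the integrand into four shapes
    \<open>?k\<close>, each with a known integral.\<close>
  have "cos (t * r) * vallee_poussin a r =
     inverse (2 * fejer_mass * a) *
      ((?k (2 * a + t) r + ?k (2 * a - t) r) - (?k (a + t) r + ?k (a - t) r))" for r
  proof (cases "r = 0")
    case False
    have 1: "cos ((b + t) * r) + cos ((b - t) * r) = 2 * cos (t * r) * cos (b * r)" for b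
      by (simp add: distrib_right left_diff_distrib cos_add cos_diff)
    have "cos (t * r) * vallee_poussin a r = cos (t * r) * (cos (a*r) - cos (2*a*r)) / (fejer_mass * a * r\<^sup>2)"
      using a fejer_mass_pos by (simp add: vallee_poussin_def fejer_def field_simps False)
    also have "\<dots> = inverse (2 * fejer_mass * a) *
      ((cos ((a + t) * r) + cos ((a - t) * r) - (cos ((2*a + t) * r) + cos ((2*a - t) * r))) / r\<^sup>2)"
      unfolding 1 using a fejer_mass_pos False by (simp add: divide_simps) (simp add: algebra_simps)
    also have "\<dots> = inverse (2 * fejer_mass * a) *
      ((?k (2 * a + t) r + ?k (2 * a - t) r) - (?k (a + t) r + ?k (a - t) r))"
      by (simp add: add_divide_distrib diff_divide_distrib)
    finally show ?thesis .
  qed (simp add: vallee_poussin_def fejer_def)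
  then have "(LINT r|lborel. cos (t * r) * vallee_poussin a r) =
    inverse (2 * fejer_mass * a) * (fejer_mass * \<bar>2 * a + t\<bar> + fejer_mass * \<bar>2 * a - t\<bar>
      - (fejer_mass * \<bar>a + t\<bar> + fejer_mass * \<bar>a - t\<bar>))"
    by (simp only: integral_mult_right_zero Bochner_Integration.integral_add
      Bochner_Integration.integral_diff Bochner_Integration.integrable_add
      integral_fejer_shape_scaled integrable_fejer_shape_scaled)
  \<comment> \<open>As |t| is at most \<open>a\<close>, all four absolute values open with positive
    sign, and 4a - 2a cancels against the prefactor.\<close>
  also have "\<dots> = 1"
    using a t fejer_mass_pos by (simp add: field_simps)
  finally show ?thesis .
qed

text \<open>The kernel is even, so the reflection of \<open>r\<close> turns the integral into its
  negative.\<close>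

lemma vallee_poussin_sin_transform:
  "(LINT r|lborel. sin (t * r) * vallee_poussin a r) = 0"
proof -
  have "(LINT r|lborel. sin (t * r) * vallee_poussin a r) = - (LINT r|lborel. sin (t * r) * vallee_poussin a r)"
    by (subst lborel_integral_real_affine[of "-1" _ 0]) auto
  then show ?thesis by simp
qed

text \<open>Fourier inversion for the triangle, verified with an explicit antiderivative obtained by
  parts. By evenness the half triangle on [0, a] and the cosine suffice.\<close>

lemma fejer_eq_integral:
  assumes a: "0 < a" and s: "s \<noteq> 0"
  shows "(LINT t|lborel. indicator {0..a} t * ((a - t) * cos (t * s)) / (fejer_mass * a)) = fejer a s"
proof -
  let ?F = "\<lambda>t. (a - t) * sin (t * s) / s - cos (t * s) / s\<^sup>2"
  have "(LINT t|lborel. ((a - t) * cos (t * s)) * indicator {0..a} t) = ?F a - ?F 0"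
  proof (rule integral_FTC_Icc_real)
    fix t
    show "DERIV ?F t :> (a - t) * cos (t * s)"
      using s by (auto intro!: derivative_eq_intros simp: field_simps power2_eq_square)
  qed (use a in auto)
  then have *: "(LINT t|lborel. ((a - t) * cos (t * s)) * indicator {0..a} t) = (1 - cos (a * s)) / s\<^sup>2"
    by (simp add: diff_divide_distrib)
  have "(LINT t|lborel. indicator {0..a} t * ((a - t) * cos (t * s)) / (fejer_mass * a))
    = (LINT t|lborel. inverse (fejer_mass * a) * (((a - t) * cos (t * s)) * indicator {0..a} t))"
    by (intro Bochner_Integration.integral_cong) (auto simp: field_simps)
  also have "\<dots> = inverse (fejer_mass * a) * ((1 - cos (a * s)) / s\<^sup>2)"
    by (simp only: integral_mult_right_zero *)
  finally show ?thesis
    by (simp add: fejer_def field_simps)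
qed

text \<open>Write the Fejer kernel as a superposition of cosines with frequencies in [0, a] and
  exchange the integrals; convolution with the trapezoid kernel leaves each of these cosines
  unchanged.\<close>

lemma fejer_reproducing:
  assumes a: "0 < a" and s: "s \<noteq> 0"
  shows "(LINT r|lborel. fejer a (s - r) * vallee_poussin a r) = fejer a s"
proof -
  let ?h = "\<lambda>t. indicator {0..a} t * (a - t) / (fejer_mass * a)"
  let ?P = "\<lambda>t r. ?h t * (cos (t * (s - r)) * vallee_poussin a r)"
  have hm[measurable]: "?h \<in> borel_measurable borel" by measurable
  have hi: "integrable lborel ?h"
  proof -
    have "integrable lborel (\<lambda>t. indicator {0..a} t *\<^sub>R ((a - t) / (fejer_mass * a)))"
      using a fejer_mass_pos by (intro borel_integrable_compact continuous_intros) auto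
    then show ?thesis by simp
  qed
  have P: "integrable (lborel \<Otimes>\<^sub>M lborel) (case_prod ?P)"
  proof (rule lborel_pair.Fubini_integrable)
    \<comment> \<open>The inner integral is at most the triangle weight times the L1 norm of the
      kernel.\<close>
    show "integrable lborel (\<lambda>t. LINT r|lborel. norm (case_prod ?P (t, r)))"
    proof (rule Bochner_Integration.integrable_bound)
      show "integrable lborel (\<lambda>t. \<bar>?h t\<bar> * (LINT r|lborel. \<bar>vallee_poussin a r\<bar>))"
        by (intro integrable_mult_left integrable_abs hi)
      have "norm (LINT r|lborel. norm (case_prod ?P (t, r))) \<le> norm (\<bar>?h t\<bar> * (LINT r|lborel. \<bar>vallee_poussin a r\<bar>))" for t
      proof -
        have i: "integrable lborel (\<lambda>r. cos (t * (s - r)) * vallee_poussin a r)"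
          by (rule integrable_mult_bounded[where B=1]) auto
        have "(LINT r|lborel. norm (case_prod ?P (t, r))) = (LINT r|lborel. \<bar>?h t\<bar> * \<bar>cos (t * (s - r)) * vallee_poussin a r\<bar>)"
          by (simp add: abs_mult)
        also have "\<dots> = \<bar>?h t\<bar> * (LINT r|lborel. \<bar>cos (t * (s - r)) * vallee_poussin a r\<bar>)"
          by (rule integral_mult_right_zero)
        also have "\<dots> \<le> \<bar>?h t\<bar> * (LINT r|lborel. \<bar>vallee_poussin a r\<bar>)"
          using integrable_abs[OF i] by (intro mult_left_mono integral_mono) (auto simp: abs_mult intro: mult_left_le_one_le)
        finally show ?thesis by simp
      qed
      then show "AE t in lborel. norm (LINT r|lborel. norm (case_prod ?P (t, r))) \<le> norm (\<bar>?h t\<bar> * (LINT r|lborel. \<bar>vallee_poussin a r\<bar>))"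
        by blast
    qed measurable
    show "AE t in lborel. integrable lborel (\<lambda>r. case_prod ?P (t, r))"
    proof (rule AE_I2)
      fix t
      have "integrable lborel (\<lambda>r. cos (t * (s - r)) * vallee_poussin a r)"
        by (rule integrable_mult_bounded[where B=1]) auto
      then show "integrable lborel (\<lambda>r. case_prod ?P (t, r))"
        unfolding prod.case by (rule integrable_mult_right)
    qed
  qed measurable
  have "(LINT r|lborel. fejer a (s - r) * vallee_poussin a r) = (LINT r|lborel. LINT t|lborel. ?P t r)"
  proof (rule integral_cong_AE)
    \<comment> \<open>The inversion formula is available except at argument 0, that is at the single
      point \<open>r = s\<close>.\<close>
    show "AE r in lborel. fejer a (s - r) * vallee_poussin a r = (LINT t|lborel. ?P t r)"
      using AE_lborel_singleton[of s]
    proof eventually_elim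
      fix r assume "r \<noteq> s"
      then have "fejer a (s - r) * vallee_poussin a r =
        (LINT t|lborel. indicator {0..a} t * ((a - t) * cos (t * (s - r))) / (fejer_mass * a)) * vallee_poussin a r"
        using fejer_eq_integral[OF a, of "s - r"] by simp
      also have "\<dots> = (LINT t|lborel. ?P t r)"
        by (subst integral_mult_left_zero[symmetric]) (simp add: mult_ac)
      finally show "fejer a (s - r) * vallee_poussin a r = (LINT t|lborel. ?P t r)" .
    qed
  qed measurable
  also have "\<dots> = (LINT t|lborel. LINT r|lborel. ?P t r)"
    by (rule lborel_pair.Fubini_integral[OF P])
  also have "\<dots> = (LINT t|lborel. indicator {0..a} t * ((a - t) * cos (t * s)) / (fejer_mass * a))"
  proof (rule Bochner_Integration.integral_cong[OF refl])
    fix t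
    have ic: "integrable lborel (\<lambda>r. cos (t * r) * vallee_poussin a r)"
      and iss: "integrable lborel (\<lambda>r. sin (t * r) * vallee_poussin a r)"
      by (rule integrable_mult_bounded[where B=1]; auto)+
    have "(LINT r|lborel. cos (t * (s - r)) * vallee_poussin a r) =
      (LINT r|lborel. cos (t * s) * (cos (t * r) * vallee_poussin a r) + sin (t * s) * (sin (t * r) * vallee_poussin a r))"
      by (intro Bochner_Integration.integral_cong) (auto simp: right_diff_distrib cos_diff algebra_simps)
    also have "\<dots> = cos (t * s) * (LINT r|lborel. cos (t * r) * vallee_poussin a r)
       + sin (t * s) * (LINT r|lborel. sin (t * r) * vallee_poussin a r)"
      using ic iss by simp
    \<comment> \<open>The support of the triangle enters here: on it the trapezoid equals 1.\<close>
    also have "\<dots> = cos (t * s)" if "t \<in> {0..a}"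
      using vallee_poussin_cos_transform[OF a, of t] that by (simp add: vallee_poussin_sin_transform)
    finally show "(LINT r|lborel. ?P t r) = indicator {0..a} t * ((a - t) * cos (t * s)) / (fejer_mass * a)"
      by (cases "t \<in> {0..a}") simp_all
  qed
  also have "\<dots> = fejer a s"
    by (rule fejer_eq_integral[OF a s])
  finally show ?thesis .
qed

section \<open>L1 modulus of continuity of the de la Vallee-Poussin kernel\<close>

definition vp_modulus :: "real \<Rightarrow> real" where
  "vp_modulus h = (LINT r|lborel. \<bar>vallee_poussin 1 (r - h) - vallee_poussin 1 r\<bar>)"

lemma integrable_vallee_poussin_shift [simp]: "integrable lborel (\<lambda>r. vallee_poussin a (r - h))"
  using lborel_integrable_real_affine[OF integrable_vallee_poussin, of 1 a "-h"] by simp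

lemma vp_modulus_measurable [measurable]: "vp_modulus \<in> borel_measurable borel"
proof -
  have [measurable]: "vallee_poussin 1 \<in> borel_measurable lborel" by simp
  show ?thesis
    unfolding vp_modulus_def[abs_def] by measurable
qed

lemma vp_modulus_nonneg: "0 \<le> vp_modulus h"
  by (simp add: vp_modulus_def)

lemma vp_modulus_le: "vp_modulus h \<le> 2 * (LINT r|lborel. \<bar>vallee_poussin 1 r\<bar>)"
proof -
  have "vp_modulus h \<le> (LINT r|lborel. \<bar>vallee_poussin 1 (r - h)\<bar> + \<bar>vallee_poussin 1 r\<bar>)"
    unfolding vp_modulus_def by (intro integral_mono) auto
  also have "\<dots> = (LINT r|lborel. \<bar>vallee_poussin 1 (r - h)\<bar>) + (LINT r|lborel. \<bar>vallee_poussin 1 r\<bar>)"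
    by simp
  also have "(LINT r|lborel. \<bar>vallee_poussin 1 (r - h)\<bar>) = (LINT r|lborel. \<bar>vallee_poussin 1 r\<bar>)"
    by (subst (2) lborel_integral_real_affine[of 1 _ "-h"]) auto
  finally show ?thesis by simp
qed

text \<open>An integrable majorant for dominated convergence. The 25/2 is 4 * 5/2 from
  \<open>2 * fejer 2 r\<close> plus 5/2 from \<open>fejer 1 r\<close>.\<close>

lemma vallee_poussin_decay:
  "\<bar>vallee_poussin 1 r\<bar> \<le> 25 / (2 * fejer_mass) * inverse (1 + r\<^sup>2)"
proof -
  have f1: "fejer 1 s \<le> 5 / (2 * fejer_mass) * inverse (1 + s\<^sup>2)" for s
    using mult_left_mono[OF fejer_shape_le[of s], of "inverse fejer_mass"] fejer_mass_pos
    by (simp add: fejer_def field_simps)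
  have "fejer 2 r = 2 * fejer 1 (2 * r)"
    by (rule fejer_scale) simp
  also have "\<dots> \<le> 2 * (5 / (2 * fejer_mass) * inverse (1 + (2 * r)\<^sup>2))"
    by (intro mult_left_mono f1) auto
  also have "\<dots> \<le> 2 * (5 / (2 * fejer_mass) * inverse (1 + r\<^sup>2))"
    using fejer_mass_pos by (intro mult_left_mono le_imp_inverse_le) (auto simp: power_mult_distrib add_pos_nonneg)
  finally have f2: "fejer 2 r \<le> 2 * (5 / (2 * fejer_mass) * inverse (1 + r\<^sup>2))" .
  have "\<bar>vallee_poussin 1 r\<bar> \<le> 2 * fejer 2 r + fejer 1 r"
    using fejer_nonneg[of 1 r] fejer_nonneg[of 2 r] by (simp add: vallee_poussin_def)
  also have "\<dots> \<le> 2 * (2 * (5 / (2 * fejer_mass) * inverse (1 + r\<^sup>2))) + 5 / (2 * fejer_mass) * inverse (1 + r\<^sup>2)"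
    by (intro add_mono mult_left_mono f1 f2) auto
  also have "\<dots> = 25 / (2 * fejer_mass) * inverse (1 + r\<^sup>2)"
    by (simp add: field_simps)
  finally show ?thesis .
qed

text \<open>Makes the majorant uniform over shifts of size at most 1, through r^2 <= 2 (r - h)^2 + 2
  h^2.\<close>

lemma inverse_one_plus_square_shift:
  fixes r h :: real
  assumes "\<bar>h\<bar> \<le> 1"
  shows "inverse (1 + (r - h)\<^sup>2) \<le> 3 * inverse (1 + r\<^sup>2)"
proof -
  have "h\<^sup>2 \<le> 1" using assms by (simp add: abs_square_le_1)
  moreover have "r\<^sup>2 \<le> 2 * (r - h)\<^sup>2 + 2 * h\<^sup>2"
    using zero_le_power2[of "r - 2 * h"] by (simp add: power2_eq_square algebra_simps)
  ultimately have "1 + r\<^sup>2 \<le> 3 * (1 + (r - h)\<^sup>2)"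
    using zero_le_power2[of "r - h"] by argo
  moreover have "0 < 1 + r\<^sup>2" "0 < 1 + (r - h)\<^sup>2" by (auto simp: add_pos_nonneg)
  ultimately show ?thesis by (simp add: field_simps)
qed

text \<open>Continuity of translation in L1, obtained here by dominated convergence.\<close>

lemma vp_modulus_tendsto_0:
  assumes "h \<longlonglongrightarrow> 0"
  shows "(\<lambda>n. vp_modulus (h n)) \<longlonglongrightarrow> 0"
proof -
  let ?V = "vallee_poussin 1"
  \<comment> \<open>From index \<open>N\<close> on the shifts are at most 1, so that the uniform
    majorant applies.\<close>
  obtain N where N: "\<bar>h n\<bar> \<le> 1" if "n \<ge> N" for n
    using LIMSEQ_D[OF assms, of 1] by (auto intro: less_imp_le)
  have "(\<lambda>n. LINT r|lborel. \<bar>?V (r - h (n + N)) - ?V r\<bar>) \<longlonglongrightarrow> (LINT r|(lborel::real measure). (0::real))"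
  proof (rule integral_dominated_convergence)
    show "integrable lborel (\<lambda>r. 50 / fejer_mass * inverse (1 + r\<^sup>2))"
      using integrable_inverse_one_plus_square by (rule integrable_mult_right)
    \<comment> \<open>The value 0 at the origin makes the kernel discontinuous there, so this null
      set is discarded.\<close>
    show "AE r in lborel. (\<lambda>n. \<bar>?V (r - h (n + N)) - ?V r\<bar>) \<longlonglongrightarrow> 0"
      using AE_lborel_singleton[of 0]
    proof eventually_elim
      fix r :: real assume r: "r \<noteq> 0"
      have "isCont ?V r"
        unfolding vallee_poussin_def fejer_def using r fejer_mass_pos by (auto intro!: continuous_intros)
      moreover have "(\<lambda>n. r - h (n + N)) \<longlonglongrightarrow> r"
        using tendsto_diff[OF tendsto_const LIMSEQ_ignore_initial_segment[OF assms]] by simp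
      ultimately have "(\<lambda>n. ?V (r - h (n + N))) \<longlonglongrightarrow> ?V r"
        by (rule isCont_tendsto_compose)
      from tendsto_rabs_zero[OF LIM_zero[OF this]]
      show "(\<lambda>n. \<bar>?V (r - h (n + N)) - ?V r\<bar>) \<longlonglongrightarrow> 0" .
    qed
    show "AE r in lborel. norm \<bar>?V (r - h (n + N)) - ?V r\<bar> \<le> 50 / fejer_mass * inverse (1 + r\<^sup>2)" for n
    proof (rule AE_I2)
      fix r :: real
      let ?D = "25 / (2 * fejer_mass)"
      have "\<bar>?V (r - h (n + N)) - ?V r\<bar> \<le> \<bar>?V (r - h (n + N))\<bar> + \<bar>?V r\<bar>" by simp
      also have "\<dots> \<le> ?D * inverse (1 + (r - h (n + N))\<^sup>2) + ?D * inverse (1 + r\<^sup>2)"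
        by (intro add_mono vallee_poussin_decay)
      also have "\<dots> \<le> ?D * (3 * inverse (1 + r\<^sup>2)) + ?D * inverse (1 + r\<^sup>2)"
        using fejer_mass_pos by (intro add_mono mult_left_mono inverse_one_plus_square_shift N) auto
      also have "\<dots> = (4 * ?D) * inverse (1 + r\<^sup>2)" by (simp add: algebra_simps)
      also have "4 * ?D = 50 / fejer_mass" by simp
      finally show "norm \<bar>?V (r - h (n + N)) - ?V r\<bar> \<le> 50 / fejer_mass * inverse (1 + r\<^sup>2)" by simp
    qed
  qed measurable
  then show ?thesis
    unfolding vp_modulus_def by (simp add: LIMSEQ_offset)
qed

section \<open>A Bernstein estimate for Fejer averages on the line\<close>

lemma integrable_bounded_mult_of_real:
  fixes g :: "'b \<Rightarrow> complex" and k :: "'b \<Rightarrow> real"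
  assumes "integrable M k" "g \<in> borel_measurable M" "\<And>x. norm (g x) \<le> B"
  shows "integrable M (\<lambda>x. g x * of_real (k x))"
  by (rule integrable_mult_bounded[OF _ assms(2,3)]) (use assms(1) in simp)

text \<open>A Fejer average has its spectrum in [-a, a], where the trapezoid is 1. Concretely,
  Fubini reduces the claim to \<open>fejer_reproducing\<close>.\<close>

lemma fejer_average_reproducing:
  fixes g :: "real \<Rightarrow> complex"
  assumes a: "0 < a" and [measurable]: "g \<in> borel_measurable borel" and g: "\<And>x. norm (g x) \<le> M"
  defines "G \<equiv> \<lambda>u. LINT s|lborel. g (u + s) * of_real (fejer a s)"
  shows "(LINT r|lborel. G (u + r) * of_real (vallee_poussin a r)) = G u"
proof -
  let ?P = "\<lambda>r s. g (u + s) * of_real (fejer a (s - r)) * of_real (vallee_poussin a r)"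
  have fi: "integrable lborel (\<lambda>s. fejer a (s - r))" for r
    using lborel_integrable_real_affine[OF integrable_fejer, of 1 a "-r"] by simp
  have fI: "(LINT s|lborel. fejer a (s - r)) = 1" for r
    using lborel_integral_real_affine[of 1 "fejer a" "-r"] integral_fejer[OF a] by simp
  have M: "0 \<le> M" using g[of 0] norm_ge_zero order_trans by blast
  have P: "integrable (lborel \<Otimes>\<^sub>M lborel) (case_prod ?P)"
  proof (rule lborel_pair.Fubini_integrable)
    show i: "AE r in lborel. integrable lborel (\<lambda>s. case_prod ?P (r, s))"
      by (auto intro!: integrable_mult_left integrable_bounded_mult_of_real[OF fi _ g])
    show "integrable lborel (\<lambda>r. LINT s|lborel. norm (case_prod ?P (r, s)))"
    proof (rule Bochner_Integration.integrable_bound)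
      show "integrable lborel (\<lambda>r. M * \<bar>vallee_poussin a r\<bar>)"
        by (intro integrable_mult_right integrable_abs) simp
      have "norm (LINT s|lborel. norm (case_prod ?P (r, s))) \<le> norm (M * \<bar>vallee_poussin a r\<bar>)" for r
      proof -
        have "(LINT s|lborel. norm (case_prod ?P (r, s))) \<le> (LINT s|lborel. (M * \<bar>vallee_poussin a r\<bar>) * fejer a (s - r))"
        proof (rule integral_mono)
          show "integrable lborel (\<lambda>s. norm (case_prod ?P (r, s)))"
            by (auto intro!: integrable_norm integrable_mult_left integrable_bounded_mult_of_real[OF fi _ g])
          show "integrable lborel (\<lambda>s. (M * \<bar>vallee_poussin a r\<bar>) * fejer a (s - r))"
            using fi by (rule integrable_mult_right)
          fix s
          have "cmod (g (u + s)) * (fejer a (s - r) * \<bar>vallee_poussin a r\<bar>) \<le> M * (fejer a (s - r) * \<bar>vallee_poussin a r\<bar>)"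
            using fejer_nonneg[OF a, of "s - r"] by (intro mult_right_mono g) auto
          then show "norm (case_prod ?P (r, s)) \<le> (M * \<bar>vallee_poussin a r\<bar>) * fejer a (s - r)"
            using fejer_nonneg[OF a, of "s - r"] by (simp add: norm_mult mult_ac)
        qed
        also have "\<dots> = M * \<bar>vallee_poussin a r\<bar>"
          by (simp add: fI)
        finally show ?thesis using M by simp
      qed
      then show "AE r in lborel. norm (LINT s|lborel. norm (case_prod ?P (r, s))) \<le> norm (M * \<bar>vallee_poussin a r\<bar>)"
        by blast
    qed measurable
  qed measurable
  have "(LINT r|lborel. G (u + r) * of_real (vallee_poussin a r)) = (LINT r|lborel. LINT s|lborel. ?P r s)"
  proof (rule Bochner_Integration.integral_cong[OF refl])
    fix r
    \<comment> \<open>Substituting \<open>s - r\<close> for \<open>s\<close> moves the shift from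
      \<open>g\<close> to the kernel.\<close>
    have "G (u + r) = (LINT s|lborel. g (u + s) * of_real (fejer a (s - r)))"
      unfolding G_def by (subst lborel_integral_real_affine[of 1 _ "- r"]) (auto simp: algebra_simps)
    then show "G (u + r) * of_real (vallee_poussin a r) = (LINT s|lborel. ?P r s)"
      by simp
  qed
  also have "\<dots> = (LINT s|lborel. LINT r|lborel. ?P r s)"
    by (rule lborel_pair.Fubini_integral[OF P, symmetric])
  also have "\<dots> = G u"
    unfolding G_def
  proof (rule integral_cong_AE)
    show "AE s in lborel. (LINT r|lborel. ?P r s) = g (u + s) * of_real (fejer a s)"
      using AE_lborel_singleton[of 0]
    proof eventually_elim
      fix s :: real assume s: "s \<noteq> 0"
      have "(LINT r|lborel. ?P r s) = (LINT r|lborel. g (u + s) * of_real (fejer a (s - r) * vallee_poussin a r))"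
        by (simp add: mult_ac)
      also have "\<dots> = g (u + s) * of_real (LINT r|lborel. fejer a (s - r) * vallee_poussin a r)"
        by (simp only: integral_mult_right_zero integral_complex_of_real)
      also have "\<dots> = g (u + s) * of_real (fejer a s)"
        by (simp add: fejer_reproducing[OF a s])
      finally show "(LINT r|lborel. ?P r s) = g (u + s) * of_real (fejer a s)" .
    qed
  qed measurable
  finally show ?thesis .
qed

text \<open>A Bernstein-type estimate: the oscillation of \<open>G\<close> is measured against \<open>sup |G|\<close>,
  not against the possibly much larger \<open>sup |g|\<close>.\<close>

lemma fejer_average_modulus:
  fixes g :: "real \<Rightarrow> complex"
  assumes a: "0 < a" and [measurable]: "g \<in> borel_measurable borel" and g: "\<And>x. norm (g x) \<le> M"
  defines "G \<equiv> \<lambda>u. LINT s|lborel. g (u + s) * of_real (fejer a s)"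
  assumes S: "\<And>u. norm (G u) \<le> S"
  shows "norm (G u - G 0) \<le> S * vp_modulus (a * u)"
proof -
  let ?V = "vallee_poussin"
  have [measurable]: "G \<in> borel_measurable borel"
    unfolding G_def by measurable
  have rep: "(LINT r|lborel. G (v + r) * of_real (?V a r)) = G v" for v
    unfolding G_def by (rule fejer_average_reproducing[OF a _ g]) measurable
  \<comment> \<open>With the shift placed on the kernel, an increment of \<open>G\<close> becomes
    \<open>G\<close> integrated against an increment of the kernel.\<close>
  have "G u = (LINT r|lborel. G r * of_real (?V a (r - u)))"
    unfolding rep[of u, symmetric]
    by (subst lborel_integral_real_affine[of 1 _ "- u"]) (auto simp: algebra_simps)
  moreover have "G 0 = (LINT r|lborel. G r * of_real (?V a r))"
    using rep[of 0] by simp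
  moreover have i1: "integrable lborel (\<lambda>r. G r * of_real (?V a (r - u)))"
    and i2: "integrable lborel (\<lambda>r. G r * of_real (?V a r))"
    by (rule integrable_bounded_mult_of_real[OF _ _ S]; simp)+
  ultimately have "G u - G 0 = (LINT r|lborel. G r * of_real (?V a (r - u)) - G r * of_real (?V a r))"
    by simp
  also have "norm \<dots> \<le> (LINT r|lborel. S * \<bar>?V a (r - u) - ?V a r\<bar>)"
  proof (rule order_trans[OF integral_norm_bound], rule integral_mono)
    show "integrable lborel (\<lambda>r. norm (G r * of_real (?V a (r - u)) - G r * of_real (?V a r)))"
      using i1 i2 by simp
    show "integrable lborel (\<lambda>r. S * \<bar>?V a (r - u) - ?V a r\<bar>)"
      by simp
    fix r
    have "norm (G r * of_real (?V a (r - u)) - G r * of_real (?V a r)) = norm (G r) * \<bar>?V a (r - u) - ?V a r\<bar>"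
      by (simp only: right_diff_distrib[symmetric] of_real_diff[symmetric] norm_mult norm_of_real)
    also have "\<dots> \<le> S * \<bar>?V a (r - u) - ?V a r\<bar>"
      by (intro mult_right_mono S) auto
    finally show "norm (G r * of_real (?V a (r - u)) - G r * of_real (?V a r)) \<le> S * \<bar>?V a (r - u) - ?V a r\<bar>" .
  qed
  \<comment> \<open>The L1 norm is invariant under dilation, so scale \<open>a\<close> and shift
    \<open>u\<close> reduce to scale 1 and shift \<open>a * u\<close>.\<close>
  also have "\<dots> = S * (a * (LINT r|lborel. \<bar>?V 1 (a * r - a * u) - ?V 1 (a * r)\<bar>))"
  proof -
    have "?V a (r - u) - ?V a r = a * (?V 1 (a * r - a * u) - ?V 1 (a * r))" for r
      using a vallee_poussin_scale[of a "r - u"] vallee_poussin_scale[of a r] by (simp add: right_diff_distrib)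
    then have "\<bar>?V a (r - u) - ?V a r\<bar> = a * \<bar>?V 1 (a * r - a * u) - ?V 1 (a * r)\<bar>" for r
      using a by (simp add: abs_mult)
    then show ?thesis by simp
  qed
  also have "a * (LINT r|lborel. \<bar>?V 1 (a * r - a * u) - ?V 1 (a * r)\<bar>) = vp_modulus (a * u)"
    unfolding vp_modulus_def using a
    by (subst (2) lborel_integral_real_affine[of a _ 0]) auto
  finally show ?thesis .
qed

section \<open>Averaging operators and modulated Fejer means\<close>

definition bounded_continuous :: "('a::topological_space \<Rightarrow> complex) \<Rightarrow> bool" where
  "bounded_continuous \<phi> \<longleftrightarrow> continuous_on UNIV \<phi> \<and> bounded (range \<phi>)"

text \<open>One operator covers both uses: smoothing along a line
  (\<open>g s = s *\<^sub>R e\<close> with a kernel \<open>k\<close>) and averaging against a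
  measure (\<open>g = id\<close>, \<open>k = 1\<close>).\<close>

definition average ::
  "'b measure \<Rightarrow> ('b \<Rightarrow> 'a::euclidean_space) \<Rightarrow> ('b \<Rightarrow> complex) \<Rightarrow> ('a \<Rightarrow> complex) \<Rightarrow> 'a \<Rightarrow> complex" where
  "average M g k \<phi> x = (LINT s|M. \<phi> (x + g s) * k s)"

lemma bounded_continuousE:
  assumes "bounded_continuous \<phi>"
  obtains B where "\<And>x. norm (\<phi> x) \<le> B" "0 \<le> B" "continuous_on UNIV \<phi>" "\<phi> \<in> borel_measurable borel"
proof -
  from assms obtain B where B: "\<And>x. norm (\<phi> x) \<le> B" and c: "continuous_on UNIV \<phi>"
    by (auto simp: bounded_continuous_def bounded_iff)
  have "0 \<le> B" using B[of undefined] norm_ge_zero order_trans by blast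
  with B c that show ?thesis by (auto intro: borel_measurable_continuous_onI)
qed

lemma integrable_average:
  fixes \<phi> :: "'a::euclidean_space \<Rightarrow> complex"
  assumes \<phi>: "bounded_continuous \<phi>" and [measurable]: "g \<in> borel_measurable M" and k: "integrable M k"
  shows "integrable M (\<lambda>s. \<phi> (x + g s) * k s)"
proof -
  obtain B where B: "\<And>x. norm (\<phi> x) \<le> B" and [measurable]: "\<phi> \<in> borel_measurable borel"
    using bounded_continuousE[OF \<phi>] by blast
  show ?thesis by (rule integrable_mult_bounded[OF k _ B]) measurable
qed

lemma norm_average_le:
  assumes \<phi>: "bounded_continuous \<phi>" "\<And>x. norm (\<phi> x) \<le> B"
    and g: "g \<in> borel_measurable M" and k: "integrable M k"
  shows "norm (average M g k \<phi> x) \<le> B * (LINT s|M. norm (k s))"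
proof -
  have "norm (average M g k \<phi> x) \<le> (LINT s|M. norm (\<phi> (x + g s) * k s))"
    unfolding average_def by (rule integral_norm_bound)
  also have "\<dots> \<le> (LINT s|M. B * norm (k s))"
    using integrable_norm[OF integrable_average[OF \<phi>(1) g k, of x]] k
    by (intro integral_mono) (auto simp: norm_mult intro!: mult_right_mono \<phi>(2))
  finally show ?thesis by simp
qed

lemma bounded_continuous_average:
  assumes \<phi>: "bounded_continuous \<phi>" and g: "g \<in> borel_measurable M" and k: "integrable M k"
  shows "bounded_continuous (average M g k \<phi>)"
  unfolding bounded_continuous_def
proof
  obtain B where B: "\<And>x. norm (\<phi> x) \<le> B" and c: "continuous_on UNIV \<phi>" and m[measurable]: "\<phi> \<in> borel_measurable borel"
    using bounded_continuousE[OF \<phi>] by blast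
  show "bounded (range (average M g k \<phi>))"
    using norm_average_le[OF \<phi> B g k] by (auto simp: bounded_iff)
  show "continuous_on UNIV (average M g k \<phi>)"
    unfolding continuous_on_sequentially
  proof (intro allI ballI impI, elim conjE)
    fix X :: "nat \<Rightarrow> 'a" and x assume X: "X \<longlonglongrightarrow> x"
    have "(\<lambda>n. LINT s|M. \<phi> (X n + g s) * k s) \<longlonglongrightarrow> (LINT s|M. \<phi> (x + g s) * k s)"
    proof (rule integral_dominated_convergence)
      show "integrable M (\<lambda>s. B * norm (k s))" using k by simp
      show "(\<lambda>s. \<phi> (x + g s) * k s) \<in> borel_measurable M"
        "\<And>n. (\<lambda>s. \<phi> (X n + g s) * k s) \<in> borel_measurable M"
        using integrable_average[OF \<phi> g k, THEN borel_measurable_integrable] by blast+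
      show "AE s in M. (\<lambda>n. \<phi> (X n + g s) * k s) \<longlonglongrightarrow> \<phi> (x + g s) * k s"
        using c by (auto intro!: AE_I2 tendsto_mult continuous_on_tendsto_compose[OF c] tendsto_add X)
      show "\<And>n. AE s in M. norm (\<phi> (X n + g s) * k s) \<le> B * norm (k s)"
        by (auto simp: norm_mult intro!: mult_right_mono B)
    qed
    then show "(average M g k \<phi> \<circ> X) \<longlonglongrightarrow> average M g k \<phi> x"
      by (simp add: average_def comp_def)
  qed
qed

text \<open>Translations commute, so this is Fubini. It lets Fejer means in different directions,
  and the average against a measure, be applied in any order.\<close>

lemma average_commute:
  assumes \<phi>: "bounded_continuous \<phi>" and M: "sigma_finite_measure M" "sigma_finite_measure N"
    and g[measurable]: "g \<in> borel_measurable M" "h \<in> borel_measurable N"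
    and k: "integrable M k" and l: "integrable N l"
  shows "average M g k (average N h l \<phi>) = average N h l (average M g k \<phi>)"
proof
  fix x
  interpret pair_sigma_finite N M
    using M by (simp add: pair_sigma_finite_def)
  obtain B where B: "\<And>x. norm (\<phi> x) \<le> B" "0 \<le> B" and m[measurable]: "\<phi> \<in> borel_measurable borel"
    using bounded_continuousE[OF \<phi>] by blast
  have [measurable]: "k \<in> borel_measurable M" "l \<in> borel_measurable N"
    using k l by auto
  let ?P = "\<lambda>r s. \<phi> (x + g s + h r) * l r * k s"
  have i: "integrable M (\<lambda>s. ?P r s)" for r
    using integrable_mult_left[OF integrable_average[OF \<phi> g(1) k, of "x + h r"], of "l r"]
    by (simp add: algebra_simps)
  have P: "integrable (N \<Otimes>\<^sub>M M) (case_prod ?P)"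
  proof (rule Fubini_integrable)
    show "AE r in N. integrable M (\<lambda>s. case_prod ?P (r, s))"
      using i by simp
    show "integrable N (\<lambda>r. LINT s|M. norm (case_prod ?P (r, s)))"
    proof (rule Bochner_Integration.integrable_bound)
      show "integrable N (\<lambda>r. norm (l r) * (B * (LINT s|M. norm (k s))))"
        using l by (intro integrable_mult_left integrable_norm)
      have "norm (LINT s|M. norm (case_prod ?P (r, s))) \<le> norm (norm (l r) * (B * (LINT s|M. norm (k s))))" for r
      proof -
        have "(LINT s|M. norm (case_prod ?P (r, s))) \<le> (LINT s|M. norm (l r) * (B * norm (k s)))"
        proof (rule integral_mono)
          show "integrable M (\<lambda>s. norm (case_prod ?P (r, s)))" using i by simp
          show "integrable M (\<lambda>s. norm (l r) * (B * norm (k s)))" using k by simp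
          fix s
          have "norm (\<phi> (x + g s + h r)) * (norm (l r) * norm (k s)) \<le> B * (norm (l r) * norm (k s))"
            by (intro mult_right_mono B) auto
          then show "norm (case_prod ?P (r, s)) \<le> norm (l r) * (B * norm (k s))"
            by (simp add: norm_mult mult_ac)
        qed
        then show ?thesis using B by simp
      qed
      then show "AE r in N. norm (LINT s|M. norm (case_prod ?P (r, s))) \<le> norm (norm (l r) * (B * (LINT s|M. norm (k s))))"
        by blast
    qed measurable
  qed measurable
  have "average M g k (average N h l \<phi>) x = (LINT s|M. LINT r|N. ?P r s)"
    by (simp add: average_def)
  also have "\<dots> = (LINT r|N. LINT s|M. ?P r s)"
    by (rule Fubini_integral[OF P])
  also have "\<dots> = (LINT r|N. LINT s|M. (\<phi> (x + h r + g s) * k s) * l r)"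
    by (simp add: algebra_simps)
  also have "\<dots> = average N h l (average M g k \<phi>) x"
    by (simp add: average_def)
  finally show "average M g k (average N h l \<phi>) x = average N h l (average M g k \<phi>) x" .
qed

text \<open>A band-pass filter: for a unit vector \<open>e\<close> and \<open>a > 0\<close> it
  multiplies exp(i r (x.e)) by max(0, 1 - |r - t| / a), so only frequencies along \<open>e\<close>
  within \<open>a\<close> of \<open>t\<close> survive.\<close>

definition fejer_mean :: "'a::euclidean_space \<Rightarrow> real \<Rightarrow> real \<Rightarrow> ('a \<Rightarrow> complex) \<Rightarrow> 'a \<Rightarrow> complex" where
  "fejer_mean e a t = average lborel (\<lambda>s. s *\<^sub>R e) (\<lambda>s. cis (- (t * s)) * of_real (fejer a s))"

lemma cis_measurable [measurable]: "cis \<in> borel_measurable borel"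
  by (intro borel_measurable_continuous_onI continuous_intros)

lemma integrable_modulated_fejer [simp]:
  "integrable lborel (\<lambda>s. cis (- (t * s)) * complex_of_real (fejer a s))"
  by (rule integrable_bounded_mult_of_real[where B=1]) auto

lemma bounded_continuous_fejer_mean [simp]:
  "bounded_continuous \<phi> \<Longrightarrow> bounded_continuous (fejer_mean e a t \<phi>)"
  unfolding fejer_mean_def by (intro bounded_continuous_average) auto

lemma norm_fejer_mean_le:
  assumes "0 < a" "bounded_continuous \<phi>" "\<And>x. norm (\<phi> x) \<le> B"
  shows "norm (fejer_mean e a t \<phi> x) \<le> B"
proof -
  have "norm (fejer_mean e a t \<phi> x) \<le> B * (LINT s|lborel. norm (cis (- (t * s)) * complex_of_real (fejer a s)))"
    unfolding fejer_mean_def by (rule norm_average_le[OF assms(2,3)]) auto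
  also have "(LINT s|lborel. norm (cis (- (t * s)) * complex_of_real (fejer a s))) = 1"
    using fejer_nonneg[OF assms(1)] integral_fejer[OF assms(1)] by (simp add: norm_mult)
  finally show ?thesis by simp
qed

lemma fejer_mean_commute:
  "bounded_continuous \<phi> \<Longrightarrow>
    fejer_mean e a t (fejer_mean e' a' t' \<phi>) = fejer_mean e' a' t' (fejer_mean e a t \<phi>)"
  unfolding fejer_mean_def by (rule average_commute) (auto intro: lborel.sigma_finite_measure_axioms)

text \<open>Along the line through \<open>x\<close> in direction \<open>e\<close>, removing the
  oscillation \<open>cis (t * u)\<close> leaves an unmodulated Fejer average, to which the Bernstein
  estimate applies.\<close>

lemma fejer_mean_modulus:
  assumes a: "0 < a" and \<phi>: "bounded_continuous \<phi>" and S: "\<And>x. norm (fejer_mean e a t \<phi> x) \<le> S"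
  shows "norm (fejer_mean e a t \<phi> (x + u *\<^sub>R e) - cis (t * u) * fejer_mean e a t \<phi> x) \<le> S * vp_modulus (a * u)"
proof -
  obtain B where B: "\<And>x. norm (\<phi> x) \<le> B" and m[measurable]: "\<phi> \<in> borel_measurable borel"
    using bounded_continuousE[OF \<phi>] by blast
  let ?\<psi> = "fejer_mean e a t \<phi>"
  define g where "g = (\<lambda>s. \<phi> (x + s *\<^sub>R e) * cis (- (t * s)))"
  define G where "G = (\<lambda>u. LINT s|lborel. g (u + s) * of_real (fejer a s))"
  have G: "G u = cis (- (t * u)) * ?\<psi> (x + u *\<^sub>R e)" for u
  proof -
    have "G u = (LINT s|lborel. cis (- (t * u)) * (\<phi> (x + u *\<^sub>R e + s *\<^sub>R e) * (cis (- (t * s)) * of_real (fejer a s))))"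
      unfolding G_def
    proof (rule Bochner_Integration.integral_cong[OF refl])
      fix s
      have "cis (- (t * (u + s))) = cis (- (t * u)) * cis (- (t * s))"
        by (simp add: cis_mult algebra_simps)
      then show "g (u + s) * of_real (fejer a s) = cis (- (t * u)) * (\<phi> (x + u *\<^sub>R e + s *\<^sub>R e) * (cis (- (t * s)) * of_real (fejer a s)))"
        by (simp add: g_def scaleR_add_left add.assoc)
    qed
    then show ?thesis by (simp add: fejer_mean_def average_def)
  qed
  have "norm (G u - G 0) \<le> S * vp_modulus (a * u)"
    unfolding G_def
  proof (rule fejer_average_modulus[OF a])
    show "g \<in> borel_measurable borel" unfolding g_def by measurable
    show "norm (g s) \<le> B" for s by (simp add: g_def norm_mult B)
    show "norm (LINT s|lborel. g (u + s) * of_real (fejer a s)) \<le> S" for u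
      using S G[of u] by (simp add: G_def norm_mult)
  qed
  moreover have "?\<psi> (x + u *\<^sub>R e) - cis (t * u) * ?\<psi> x = cis (t * u) * (G u - G 0)"
  proof -
    have "cis (t * u) * cis (- (t * u)) = 1" by (simp add: cis_mult)
    then show ?thesis by (simp add: G right_diff_distrib flip: mult.assoc)
  qed
  ultimately show ?thesis by (simp add: norm_mult)
qed

text \<open>This is \<open>1 - cos (2 a s) = 2 (1 - cos (a s)) (1 + cos (a s))\<close>: a wide triangle on the
  Fourier side is a combination of three narrow ones.\<close>

lemma fejer_mean_halving:
  assumes a: "0 < a" and \<phi>: "bounded_continuous \<phi>"
  shows "fejer_mean e (2 * a) t \<phi> x =
    fejer_mean e a t \<phi> x + (fejer_mean e a (t + a) \<phi> x + fejer_mean e a (t - a) \<phi> x) / 2"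
proof -
  let ?k = "\<lambda>a t s. cis (- (t * s)) * complex_of_real (fejer a s)"
  have f: "fejer (2 * a) s = fejer a s * (1 + cos (a * s))" for s
  proof -
    have "1 - cos (2 * a * s) = 2 * ((1 - cos (a * s)) * (1 + cos (a * s)))"
      using cos_double_cos[of "a * s"] by (simp add: algebra_simps power2_eq_square)
    then show ?thesis using a by (simp add: fejer_def)
  qed
  have k: "?k (2 * a) t s = ?k a t s + (?k a (t + a) s + ?k a (t - a) s) / 2" for s
  proof -
    have c: "cis (- ((t + a) * s)) = cis (- (t * s)) * cis (- (a * s))"
      "cis (- ((t - a) * s)) = cis (- (t * s)) * cis (a * s)"
      by (simp_all add: cis_mult algebra_simps)
    \<comment> \<open>The two exponentials in the cosine are what shifts the frequency by
      \<open>a\<close> up and down.\<close>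
    have c': "of_real (2 * cos (a * s)) = cis (a * s) + cis (- (a * s))"
      by (simp add: complex_eq_iff)
    have sum: "?k a (t + a) s + ?k a (t - a) s = cis (- (t * s)) * of_real (fejer a s) * of_real (2 * cos (a * s))"
      unfolding c c' by (simp only: algebra_simps)
    show ?thesis
      unfolding sum f by (simp add: distrib_left mult.assoc)
  qed
  have i: "integrable lborel (\<lambda>s. \<phi> (x + s *\<^sub>R e) * ?k b r s)" for b r
    by (rule integrable_average[OF \<phi>]) auto
  have "fejer_mean e (2 * a) t \<phi> x = (LINT s|lborel. \<phi> (x + s *\<^sub>R e) * ?k a t s
    + (\<phi> (x + s *\<^sub>R e) * ?k a (t + a) s + \<phi> (x + s *\<^sub>R e) * ?k a (t - a) s) / 2)"
    unfolding fejer_mean_def average_def k by (simp add: algebra_simps add_divide_distrib)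
  also have "\<dots> = fejer_mean e a t \<phi> x + (fejer_mean e a (t + a) \<phi> x + fejer_mean e a (t - a) \<phi> x) / 2"
    unfolding fejer_mean_def average_def
    by (simp only: Bochner_Integration.integral_add Bochner_Integration.integrable_add integrable_divide_zero integral_divide_zero i)
  finally show ?thesis .
qed

text \<open>The weights 1, 1/2, 1/2 in the halving identity sum to 2, so one of the three narrower
  means keeps at least half of the size. The frequency moves by at most the new width each time, in
  total at most a/2 + ... + a/2^m = a - a/2^m.\<close>

lemma fejer_mean_bisection:
  assumes a: "0 < a" and \<phi>: "bounded_continuous \<phi>"
  shows "\<exists>t'. \<bar>t'\<bar> \<le> a - a / 2 ^ m \<and> norm (fejer_mean e a 0 \<phi> x) / 2 ^ m \<le> norm (fejer_mean e (a / 2 ^ m) t' \<phi> x)"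
proof (induction m)
  case 0
  show ?case by (intro exI[of _ 0]) simp
next
  case (Suc m)
  let ?b = "a / 2 ^ Suc m"
  have b: "0 < ?b" "2 * ?b = a / 2 ^ m" using a by auto
  from Suc obtain t' where t': "\<bar>t'\<bar> \<le> a - a / 2 ^ m"
    "norm (fejer_mean e a 0 \<phi> x) / 2 ^ m \<le> norm (fejer_mean e (2 * ?b) t' \<phi> x)"
    unfolding b by blast
  let ?n = "\<lambda>t. norm (fejer_mean e ?b t \<phi> x)"
  let ?v = "norm (fejer_mean e (2 * ?b) t' \<phi> x)"
  have "?v \<le> ?n t' + norm (fejer_mean e ?b (t' + ?b) \<phi> x + fejer_mean e ?b (t' - ?b) \<phi> x) / 2"
    unfolding fejer_mean_halving[OF b(1) \<phi>]
    using norm_triangle_ineq[of "fejer_mean e ?b t' \<phi> x" "(fejer_mean e ?b (t' + ?b) \<phi> x + fejer_mean e ?b (t' - ?b) \<phi> x) / 2"]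
    by (simp add: norm_divide)
  also have "\<dots> \<le> ?n t' + (?n (t' + ?b) + ?n (t' - ?b)) / 2"
    by (intro add_left_mono divide_right_mono norm_triangle_ineq) simp
  finally have "?v / 2 \<le> ?n t' \<or> ?v / 2 \<le> ?n (t' + ?b) \<or> ?v / 2 \<le> ?n (t' - ?b)"
    by argo
  then obtain t'' where "t'' = t' \<or> t'' = t' + ?b \<or> t'' = t' - ?b" "?v / 2 \<le> ?n t''"
    by blast
  moreover from this(1) have "\<bar>t''\<bar> \<le> a - ?b"
    using t'(1) b by (auto simp: abs_if split: if_splits)
  ultimately show ?case
    using t'(2) by (intro exI[of _ t'']) auto
qed

section \<open>Fejer means in several directions\<close>

text \<open>Smoothing with a product kernel, one direction at a time, so that Fourier analysis on
  the line suffices; \<open>t e\<close> is the frequency along \<open>e\<close>.\<close>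

definition fejer_means :: "'a::euclidean_space list \<Rightarrow> real \<Rightarrow> ('a \<Rightarrow> real) \<Rightarrow> ('a \<Rightarrow> complex) \<Rightarrow> 'a \<Rightarrow> complex" where
  "fejer_means es a t \<phi> = foldr (\<lambda>e. fejer_mean e a (t e)) es \<phi>"

lemma fejer_means_simps [simp]:
  "fejer_means [] a t \<phi> = \<phi>"
  "fejer_means (e # es) a t \<phi> = fejer_mean e a (t e) (fejer_means es a t \<phi>)"
  by (simp_all add: fejer_means_def)

lemma bounded_continuous_fejer_means [simp]:
  "bounded_continuous \<phi> \<Longrightarrow> bounded_continuous (fejer_means es a t \<phi>)"
  by (induction es) auto

lemma norm_fejer_means_le:
  assumes "0 < a" "bounded_continuous \<phi>" "\<And>x. norm (\<phi> x) \<le> B"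
  shows "norm (fejer_means es a t \<phi> x) \<le> B"
  using assms by (induction es arbitrary: x) (auto intro: norm_fejer_mean_le)

lemma fejer_means_average_commute:
  assumes "bounded_continuous \<phi>" "sigma_finite_measure M" "g \<in> borel_measurable M" "integrable M k"
  shows "average M g k (fejer_means es a t \<phi>) = fejer_means es a t (average M g k \<phi>)"
proof (induction es)
  case (Cons e es)
  have "average M g k (fejer_mean e a (t e) (fejer_means es a t \<phi>)) =
    fejer_mean e a (t e) (average M g k (fejer_means es a t \<phi>))"
    unfolding fejer_mean_def using assms
    by (intro average_commute) (auto intro: lborel.sigma_finite_measure_axioms)
  then show ?case using Cons by simp
qed simp

lemma fejer_means_commute:
  "bounded_continuous \<phi> \<Longrightarrow> fejer_mean e b s (fejer_means es a t \<phi>) = fejer_means es a t (fejer_mean e b s \<phi>)"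
  unfolding fejer_mean_def[of e b s]
  by (rule fejer_means_average_commute) (auto intro: lborel.sigma_finite_measure_axioms)

lemma fejer_means_cong: "(\<And>e. e \<in> set es \<Longrightarrow> t e = t' e) \<Longrightarrow> fejer_means es a t \<phi> = fejer_means es a t' \<phi>"
  by (induction es) auto

text \<open>Since the means commute, the one in direction \<open>e\<close> can be pulled to the
  outside, where the one-dimensional modulus estimate applies.\<close>

lemma fejer_means_factor:
  assumes "bounded_continuous \<phi>" "e \<in> set es"
  shows "\<exists>\<phi>'. bounded_continuous \<phi>' \<and> fejer_means es a t \<phi> = fejer_mean e a (t e) \<phi>'"
  using assms(2)
proof (induction es)
  case (Cons e' es)
  show ?case
  proof (cases "e = e'")
    case True
    then show ?thesis using assms(1)
      by (intro exI[of _ "fejer_means es a t \<phi>"]) simp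
  next
    case False
    with Cons obtain \<phi>' where "bounded_continuous \<phi>'" "fejer_means es a t \<phi> = fejer_mean e a (t e) \<phi>'"
      by auto
    then show ?thesis
      by (intro exI[of _ "fejer_mean e' a (t e') \<phi>'"]) (simp add: fejer_mean_commute)
  qed
qed simp

text \<open>The directions are bisected in turn, each costing a factor 2^m.\<close>

lemma fejer_means_bisection:
  assumes a: "0 < a" and "bounded_continuous \<phi>" "distinct es"
  shows "\<exists>t. (\<forall>e. \<bar>t e\<bar> \<le> a) \<and>
    norm (fejer_means es a (\<lambda>_. 0) \<phi> x) / (2 ^ m) ^ length es \<le> norm (fejer_means es (a / 2 ^ m) t \<phi> x)"
  using assms(2,3)
proof (induction es arbitrary: \<phi>)
  case Nil
  show ?case using a by (intro exI[of _ "\<lambda>_. 0"]) auto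
next
  case (Cons e es)
  let ?b = "a / 2 ^ m"
  let ?z = "\<lambda>_::'a. 0::real"
  have bc: "bounded_continuous (fejer_means es a ?z \<phi>)" using Cons.prems by simp
  from fejer_mean_bisection[OF a bc, of m e x] obtain t' where
    t': "\<bar>t'\<bar> \<le> a - ?b"
      "norm (fejer_means (e # es) a ?z \<phi> x) / 2 ^ m \<le> norm (fejer_mean e ?b t' (fejer_means es a ?z \<phi>) x)"
    by auto
  \<comment> \<open>The narrow mean along \<open>e\<close> is absorbed into the function, which is
    why the induction keeps \<phi> arbitrary.\<close>
  define \<phi>1 where "\<phi>1 = fejer_mean e ?b t' \<phi>"
  have "bounded_continuous \<phi>1" "distinct es"
    using Cons.prems by (simp_all add: \<phi>1_def)
  from Cons.IH[OF this] obtain t where t: "\<And>e. \<bar>t e\<bar> \<le> a"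
    "norm (fejer_means es a ?z \<phi>1 x) / (2 ^ m) ^ length es \<le> norm (fejer_means es ?b t \<phi>1 x)"
    by blast
  have 1: "fejer_mean e ?b t' (fejer_means es a ?z \<phi>) = fejer_means es a ?z \<phi>1"
    unfolding \<phi>1_def by (rule fejer_means_commute) (rule Cons.prems)
  have 2: "fejer_means (e # es) ?b (t(e := t')) \<phi> = fejer_means es ?b t \<phi>1"
  proof -
    \<comment> \<open>Distinctness guarantees that the update at \<open>e\<close> does not touch the
      remaining directions.\<close>
    have "fejer_means es ?b (t(e := t')) \<phi> = fejer_means es ?b t \<phi>"
      using Cons.prems by (intro fejer_means_cong) auto
    then show ?thesis
      using Cons.prems by (simp add: \<phi>1_def fejer_means_commute)
  qed
  have "norm (fejer_means (e # es) a ?z \<phi> x) / (2 ^ m) ^ length (e # es)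
    = norm (fejer_means (e # es) a ?z \<phi> x) / 2 ^ m / (2 ^ m) ^ length es"
    by simp
  also have "\<dots> \<le> norm (fejer_means es a ?z \<phi>1 x) / (2 ^ m) ^ length es"
    using t'(2) unfolding 1 by (intro divide_right_mono) auto
  also have "\<dots> \<le> norm (fejer_means (e # es) ?b (t(e := t')) \<phi> x)"
    unfolding 2 by (rule t(2))
  finally have "norm (fejer_means (e # es) a ?z \<phi> x) / (2 ^ m) ^ length (e # es)
    \<le> norm (fejer_means (e # es) ?b (t(e := t')) \<phi> x)" .
  moreover have "0 \<le> ?b" using a by simp
  then have "\<bar>t'\<bar> \<le> a" using t'(1) by linarith
  then have "\<forall>e'. \<bar>(t(e := t')) e'\<bar> \<le> a"
    using t(1) by simp
  ultimately show ?case by blast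
qed

text \<open>Move from \<open>x\<close> one coordinate at a time; each move contributes its own
  modulus, always relative to the same bound \<open>S\<close> on the full mean.\<close>

lemma fejer_means_modulus_sum:
  assumes a: "0 < a" and \<phi>: "bounded_continuous \<phi>"
    and S: "\<And>x. norm (fejer_means es a t \<phi> x) \<le> S"
    and A: "finite A" "A \<subseteq> set es"
  shows "norm (fejer_means es a t \<phi> (x + (\<Sum>e\<in>A. y e *\<^sub>R e)) - cis (\<Sum>e\<in>A. t e * y e) * fejer_means es a t \<phi> x)
    \<le> S * (\<Sum>e\<in>A. vp_modulus (a * y e))"
  using A
proof (induction A)
  case empty
  show ?case by simp
next
  case (insert e A)
  let ?\<psi> = "fejer_means es a t \<phi>"
  let ?x = "x + (\<Sum>e\<in>A. y e *\<^sub>R e)" and ?c = "cis (\<Sum>e\<in>A. t e * y e)"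
  obtain \<phi>' where \<phi>': "bounded_continuous \<phi>'" "?\<psi> = fejer_mean e a (t e) \<phi>'"
    using fejer_means_factor[OF \<phi>, of e es a t] insert.prems by auto
  have 1: "norm (?\<psi> (?x + y e *\<^sub>R e) - cis (t e * y e) * ?\<psi> ?x) \<le> S * vp_modulus (a * y e)"
    using fejer_mean_modulus[OF a \<phi>'(1), of e "t e" S] S unfolding \<phi>'(2) by simp
  have 2: "norm (?\<psi> ?x - ?c * ?\<psi> x) \<le> S * (\<Sum>e\<in>A. vp_modulus (a * y e))"
    using insert by simp
  \<comment> \<open>Telescoping through the intermediate point; the phase in front of the second
    term has modulus 1.\<close>
  have "?\<psi> (?x + y e *\<^sub>R e) - cis (t e * y e + (\<Sum>e\<in>A. t e * y e)) * ?\<psi> x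
    = (?\<psi> (?x + y e *\<^sub>R e) - cis (t e * y e) * ?\<psi> ?x) + cis (t e * y e) * (?\<psi> ?x - ?c * ?\<psi> x)"
    by (simp add: algebra_simps flip: cis_mult)
  also have "norm \<dots> \<le> S * vp_modulus (a * y e) + S * (\<Sum>e\<in>A. vp_modulus (a * y e))"
    using 2 by (intro order_trans[OF norm_triangle_ineq] add_mono 1) (simp add: norm_mult)
  finally show ?case
    using insert.hyps by (simp add: algebra_simps)
qed

lemma fejer_means_modulus:
  fixes y :: "'a::euclidean_space"
  assumes "0 < a" "bounded_continuous \<phi>"
    and "\<And>x. norm (fejer_means es a t \<phi> x) \<le> S" "set es = Basis"
  shows "norm (fejer_means es a t \<phi> (x + y) - cis ((\<Sum>e\<in>Basis. t e *\<^sub>R e) \<bullet> y) * fejer_means es a t \<phi> x)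
    \<le> S * (\<Sum>e\<in>Basis. vp_modulus (a * (y \<bullet> e)))"
  using fejer_means_modulus_sum[OF assms(1-3), of Basis x "\<lambda>e. y \<bullet> e"] assms(4)
  by (simp add: inner_sum_right inner_commute[of _ y] euclidean_representation)

section \<open>Approximation of bounded Lipschitz functions by Fejer means\<close>

lemma fejer_mean_lipschitz:
  assumes a: "0 < a" and \<phi>: "bounded_continuous \<phi>" and L: "\<And>x y. norm (\<phi> x - \<phi> y) \<le> L * dist x y"
  shows "norm (fejer_mean e a t \<phi> x - fejer_mean e a t \<phi> y) \<le> L * dist x y"
proof -
  let ?k = "\<lambda>s. cis (- (t * s)) * complex_of_real (fejer a s)"
  have i: "integrable lborel (\<lambda>s. \<phi> (z + s *\<^sub>R e) * ?k s)" for z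
    by (rule integrable_average[OF \<phi>]) auto
  have "fejer_mean e a t \<phi> x - fejer_mean e a t \<phi> y = (LINT s|lborel. \<phi> (x + s *\<^sub>R e) * ?k s - \<phi> (y + s *\<^sub>R e) * ?k s)"
    unfolding fejer_mean_def average_def using i by simp
  also have "norm \<dots> \<le> (LINT s|lborel. L * dist x y * fejer a s)"
  proof (rule order_trans[OF integral_norm_bound], rule integral_mono)
    show "integrable lborel (\<lambda>s. norm (\<phi> (x + s *\<^sub>R e) * ?k s - \<phi> (y + s *\<^sub>R e) * ?k s))"
      by (intro integrable_norm Bochner_Integration.integrable_diff i)
    show "integrable lborel (\<lambda>s. L * dist x y * fejer a s)" by simp
    fix s
    have "norm (\<phi> (x + s *\<^sub>R e) * ?k s - \<phi> (y + s *\<^sub>R e) * ?k s) = norm (\<phi> (x + s *\<^sub>R e) - \<phi> (y + s *\<^sub>R e)) * fejer a s"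
      using fejer_nonneg[OF a, of s] by (simp add: norm_mult flip: left_diff_distrib)
    also have "\<dots> \<le> L * dist x y * fejer a s"
      using L[of "x + s *\<^sub>R e" "y + s *\<^sub>R e"] fejer_nonneg[OF a, of s] by (intro mult_right_mono) auto
    finally show "norm (\<phi> (x + s *\<^sub>R e) * ?k s - \<phi> (y + s *\<^sub>R e) * ?k s) \<le> L * dist x y * fejer a s" .
  qed
  also have "\<dots> = L * dist x y"
    using integral_fejer[OF a] by simp
  finally show ?thesis .
qed

text \<open>The kernel has mass one, so the error averages increments of \<phi>. They are at most
  L|s|, but |s| times the kernel is not integrable at infinity, hence the cap 2B. Rescaling moves
  \<open>a\<close> from the kernel into the minimum.\<close>

lemma fejer_mean_approx:
  assumes a: "0 < a" and \<phi>: "bounded_continuous \<phi>" "\<And>x. norm (\<phi> x) \<le> B"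
    and L: "\<And>x y. norm (\<phi> x - \<phi> y) \<le> L * dist x y" and e: "norm e = 1"
  shows "norm (fejer_mean e a 0 \<phi> x - \<phi> x) \<le> (LINT s|lborel. min (L * (\<bar>s\<bar> / a)) (2 * B) * fejer 1 s)"
proof -
  have B: "0 \<le> B" using \<phi>(2) norm_ge_zero order_trans by blast
  have L0: "0 \<le> L"
  proof -
    have "0 \<le> L * dist (x + e) x" using L norm_ge_zero order_trans by blast
    then show ?thesis using e by (simp add: dist_norm)
  qed
  have i1: "integrable lborel (\<lambda>s. \<phi> (x + s *\<^sub>R e) * complex_of_real (fejer a s))"
    by (rule integrable_average[OF \<phi>(1)]) auto
  have im: "integrable lborel (\<lambda>s. min (L * \<bar>s\<bar>) (2 * B) * fejer a s)"
    using L0 B by (intro integrable_mult_bounded[where B="2 * B"]) auto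
  have "\<phi> x = (LINT s|lborel. \<phi> x * complex_of_real (fejer a s))"
    by (simp only: integral_mult_right_zero integral_complex_of_real integral_fejer[OF a]) simp
  then have "fejer_mean e a 0 \<phi> x - \<phi> x =
    (LINT s|lborel. \<phi> (x + s *\<^sub>R e) * complex_of_real (fejer a s)) - (LINT s|lborel. \<phi> x * complex_of_real (fejer a s))"
    by (simp add: fejer_mean_def average_def)
  also have "\<dots> = (LINT s|lborel. \<phi> (x + s *\<^sub>R e) * complex_of_real (fejer a s) - \<phi> x * complex_of_real (fejer a s))"
    using i1 by simp
  also have "norm \<dots> \<le> (LINT s|lborel. min (L * \<bar>s\<bar>) (2 * B) * fejer a s)"
  proof (rule order_trans[OF integral_norm_bound], rule integral_mono)
    show "integrable lborel (\<lambda>s. norm (\<phi> (x + s *\<^sub>R e) * complex_of_real (fejer a s) - \<phi> x * complex_of_real (fejer a s)))"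
      using i1 by simp
    fix s
    have "norm (\<phi> (x + s *\<^sub>R e) - \<phi> x) \<le> L * \<bar>s\<bar>"
      using L[of "x + s *\<^sub>R e" x] e by (simp add: dist_norm)
    moreover have "norm (\<phi> (x + s *\<^sub>R e) - \<phi> x) \<le> 2 * B"
      using norm_triangle_ineq4[of "\<phi> (x + s *\<^sub>R e)" "\<phi> x"] \<phi>(2)[of "x + s *\<^sub>R e"] \<phi>(2)[of x] by linarith
    ultimately have "norm (\<phi> (x + s *\<^sub>R e) - \<phi> x) * fejer a s \<le> min (L * \<bar>s\<bar>) (2 * B) * fejer a s"
      using fejer_nonneg[OF a, of s] by (intro mult_right_mono) auto
    then show "norm (\<phi> (x + s *\<^sub>R e) * complex_of_real (fejer a s) - \<phi> x * complex_of_real (fejer a s)) \<le> min (L * \<bar>s\<bar>) (2 * B) * fejer a s"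
      using fejer_nonneg[OF a, of s] by (simp add: norm_mult flip: left_diff_distrib)
  qed (rule im)
  also have "\<dots> = (LINT s|lborel. min (L * (\<bar>s\<bar> / a)) (2 * B) * fejer 1 s)"
    using a by (subst (2) lborel_integral_real_affine[of a _ 0]) (auto simp: fejer_scale[of a] abs_mult mult_ac)
  finally show ?thesis .
qed

lemma fejer_error_tendsto_0:
  assumes "0 \<le> L" "0 \<le> B"
  shows "(\<lambda>n. LINT s|lborel. min (L * (\<bar>s\<bar> / real (Suc n))) (2 * B) * fejer 1 s) \<longlonglongrightarrow> 0"
proof -
  have "(\<lambda>n. LINT s|lborel. min (L * (\<bar>s\<bar> / real (Suc n))) (2 * B) * fejer 1 s) \<longlonglongrightarrow> (LINT s|(lborel::real measure). (0::real))"
  proof (rule integral_dominated_convergence)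
    show "integrable lborel (\<lambda>s. 2 * B * fejer 1 s)" by simp
    show "AE s in lborel. (\<lambda>n. min (L * (\<bar>s\<bar> / real (Suc n))) (2 * B) * fejer 1 s) \<longlonglongrightarrow> 0"
    proof (rule AE_I2)
      fix s :: real
      have "(\<lambda>n. \<bar>s\<bar> / real (Suc n)) \<longlonglongrightarrow> 0"
        using LIMSEQ_Suc[OF lim_const_over_n[of "\<bar>s\<bar>"]] by simp
      then have "(\<lambda>n. min (L * (\<bar>s\<bar> / real (Suc n))) (2 * B) * fejer 1 s) \<longlonglongrightarrow> min (L * 0) (2 * B) * fejer 1 s"
        by (intro tendsto_intros)
      then show "(\<lambda>n. min (L * (\<bar>s\<bar> / real (Suc n))) (2 * B) * fejer 1 s) \<longlonglongrightarrow> 0"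
        using assms by simp
    qed
    show "AE s in lborel. norm (min (L * (\<bar>s\<bar> / real (Suc n))) (2 * B) * fejer 1 s) \<le> 2 * B * fejer 1 s" for n
      using assms fejer_nonneg[of 1] by (intro AE_I2) (auto simp: abs_mult intro!: mult_right_mono)
  qed measurable
  then show ?thesis by simp
qed

text \<open>The means already applied preserve the bound \<open>B\<close> and the Lipschitz constant
  \<open>L\<close>, so each direction adds the same error.\<close>

lemma fejer_means_approx:
  fixes es :: "'a::euclidean_space list"
  assumes a: "0 < a" and \<phi>: "bounded_continuous \<phi>" "\<And>x. norm (\<phi> x) \<le> B"
    and L: "\<And>x y. norm (\<phi> x - \<phi> y) \<le> L * dist x y" and es: "\<And>e. e \<in> set es \<Longrightarrow> norm e = 1"
  shows "norm (fejer_means es a (\<lambda>_. 0) \<phi> x - \<phi> x) \<le>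
    length es * (LINT s|lborel. min (L * (\<bar>s\<bar> / a)) (2 * B) * fejer 1 s)"
  using es
proof (induction es)
  case (Cons e es)
  let ?\<psi> = "fejer_means es a (\<lambda>_. 0) \<phi>" and ?\<eta> = "LINT s|lborel. min (L * (\<bar>s\<bar> / a)) (2 * B) * fejer 1 s"
  have lip: "norm (?\<psi> x - ?\<psi> y) \<le> L * dist x y" for x y
    by (induction es arbitrary: x y) (auto intro!: L fejer_mean_lipschitz a simp: \<phi>(1))
  have "norm (fejer_mean e a 0 ?\<psi> x - ?\<psi> x) \<le> ?\<eta>"
    using a \<phi>(1) norm_fejer_means_le[OF a \<phi>] lip Cons.prems by (intro fejer_mean_approx) auto
  moreover have "norm (?\<psi> x - \<phi> x) \<le> length es * ?\<eta>"
    using Cons by simp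
  ultimately have "norm ((fejer_mean e a 0 ?\<psi> x - ?\<psi> x) + (?\<psi> x - \<phi> x)) \<le> ?\<eta> + length es * ?\<eta>"
    by (intro order_trans[OF norm_triangle_ineq] add_mono)
  then show ?case by (simp add: algebra_simps)
qed simp

section \<open>A quantitative Wiener estimate\<close>

lemma borel_probD:
  assumes "borel_prob M"
  shows "prob_space M" "sets M = sets borel" "space M = UNIV" "\<And>f. f \<in> borel_measurable borel \<Longrightarrow> f \<in> borel_measurable M"
  using assms sets_eq_imp_space_eq[of M borel] by (auto simp: borel_prob_def cong: measurable_cong_sets)

lemma char_fun_cis: "char_fun M t = (CLINT x|M. cis (t \<bullet> x))"
  by (simp add: char_fun_def cis_conv_exp)

lemma continuous_on_char_fun:
  assumes M: "borel_prob M"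
  shows "continuous_on UNIV (char_fun M)"
  unfolding continuous_on_sequentially
proof (intro allI ballI impI, elim conjE)
  interpret prob_space M using borel_probD[OF M] by simp
  have [measurable]: "(\<lambda>x. cis (t \<bullet> x)) \<in> borel_measurable M" for t
    by (intro borel_probD(4)[OF M]) measurable
  fix X :: "nat \<Rightarrow> 'a" and t assume X: "X \<longlonglongrightarrow> t"
  have "(\<lambda>n. CLINT x|M. cis (X n \<bullet> x)) \<longlonglongrightarrow> (CLINT x|M. cis (t \<bullet> x))"
    by (rule integral_dominated_convergence[where w="\<lambda>_. 1"]) (auto intro!: tendsto_intros X)
  then show "(char_fun M \<circ> X) \<longlonglongrightarrow> char_fun M t"
    by (simp add: char_fun_cis[abs_def] comp_def)
qed

lemma char_fun_bounded_below:
  assumes M: "borel_prob M" and nz: "\<And>t. char_fun M t \<noteq> 0"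
  obtains \<kappa> where "0 < \<kappa>" "\<And>t. norm t \<le> R \<Longrightarrow> \<kappa> \<le> norm (char_fun M t)"
proof (cases "0 \<le> R")
  case True
  have "continuous_on (cball 0 R) (\<lambda>t. norm (char_fun M t))"
    using continuous_on_char_fun[OF M] by (intro continuous_on_norm) (auto intro: continuous_on_subset)
  moreover have "cball (0::'a) R \<noteq> {}" using True by simp
  ultimately obtain t0 where "\<forall>t\<in>cball 0 R. norm (char_fun M t0) \<le> norm (char_fun M t)"
    using continuous_attains_inf[OF compact_cball] by blast
  then show ?thesis using nz[of t0] by (intro that[of "norm (char_fun M t0)"]) auto
next
  \<comment> \<open>For negative \<open>R\<close> no \<open>t\<close> satisfies the norm bound, so
    any positive constant will do.\<close>
  case False
  then show ?thesis
    by (intro that[of 1]) (auto dest: order_trans[OF norm_ge_zero])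
qed

lemma norm_vp_modulus_sum_le:
  fixes y :: "'a::euclidean_space"
  shows "norm (\<Sum>e\<in>Basis. vp_modulus (a * (y \<bullet> e)))
    \<le> (\<Sum>e\<in>(Basis::'a set). 2 * (LINT r|lborel. \<bar>vallee_poussin 1 r\<bar>))"
proof -
  have "norm (\<Sum>e\<in>Basis. vp_modulus (a * (y \<bullet> e))) = (\<Sum>e\<in>Basis. vp_modulus (a * (y \<bullet> e)))"
    by (simp add: sum_nonneg vp_modulus_nonneg)
  also have "\<dots> \<le> (\<Sum>e\<in>(Basis::'a set). 2 * (LINT r|lborel. \<bar>vallee_poussin 1 r\<bar>))"
    by (intro sum_mono vp_modulus_le)
  finally show ?thesis .
qed

text \<open>A narrow-band function behaves like a plane wave: integrating its modulus estimate over
  the shift \<open>y\<close> turns the phase into the characteristic function.\<close>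

lemma average_by_measure_modulus:
  assumes M: "borel_prob M" and a: "0 < a" and \<phi>: "bounded_continuous \<phi>"
    and S: "\<And>x. norm (fejer_means es a t \<phi> x) \<le> S" and es: "set es = Basis"
  shows "norm (average M id (\<lambda>_. 1) (fejer_means es a t \<phi>) x - char_fun M (\<Sum>e\<in>Basis. t e *\<^sub>R e) * fejer_means es a t \<phi> x)
    \<le> S * (LINT y|M. (\<Sum>e\<in>Basis. vp_modulus (a * (y \<bullet> e))))"
proof -
  interpret prob_space M using borel_probD[OF M] by simp
  let ?\<psi> = "fejer_means es a t \<phi>" and ?T = "\<Sum>e\<in>Basis. t e *\<^sub>R e"
  let ?W = "\<lambda>y. \<Sum>e\<in>Basis. vp_modulus (a * (y \<bullet> e))"
  have i1: "integrable M (\<lambda>y. ?\<psi> (x + id y) * 1)"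
    using \<phi> by (intro integrable_average borel_probD(4)[OF M]) auto
  have i2: "integrable M (\<lambda>y. cis (?T \<bullet> y) * ?\<psi> x)"
    by (rule integrable_const_bound[where B="norm (?\<psi> x)"])
       (auto simp: norm_mult intro!: borel_probD(4)[OF M])
  have i3: "integrable M ?W"
  proof (rule integrable_const_bound)
    show "AE y in M. norm (?W y) \<le> (\<Sum>e\<in>(Basis::'a set). 2 * (LINT r|lborel. \<bar>vallee_poussin 1 r\<bar>))"
      by (intro AE_I2 norm_vp_modulus_sum_le)
  qed (auto intro!: borel_probD(4)[OF M])
  have "average M id (\<lambda>_. 1) ?\<psi> x - char_fun M ?T * ?\<psi> x = (LINT y|M. ?\<psi> (x + id y) * 1 - cis (?T \<bullet> y) * ?\<psi> x)"
    using i1 i2 by (simp add: average_def char_fun_cis)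
  also have "norm \<dots> \<le> (LINT y|M. S * ?W y)"
  proof (rule order_trans[OF integral_norm_bound], rule integral_mono)
    show "integrable M (\<lambda>y. norm (?\<psi> (x + id y) * 1 - cis (?T \<bullet> y) * ?\<psi> x))"
      using i1 i2 by (intro integrable_norm Bochner_Integration.integrable_diff)
    show "integrable M (\<lambda>y. S * ?W y)" using i3 by simp
    show "norm (?\<psi> (x + id y) * 1 - cis (?T \<bullet> y) * ?\<psi> x) \<le> S * ?W y" for y
      using fejer_means_modulus[OF a \<phi> S es, of x y] by simp
  qed
  finally show ?thesis by simp
qed

text \<open>The modulus is bounded, so a constant dominates whatever the tails of \<open>M\<close>,
  and pointwise the shifts shrink to 0.\<close>

lemma vp_modulus_integral_tendsto_0:
  assumes M: "borel_prob M"
  shows "(\<lambda>m. LINT y|M. (\<Sum>e\<in>Basis. vp_modulus (a / 2 ^ m * (y \<bullet> e)))) \<longlonglongrightarrow> 0"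
proof -
  interpret prob_space M using borel_probD[OF M] by simp
  have "(\<lambda>m. LINT y|M. (\<Sum>e\<in>Basis. vp_modulus (a / 2 ^ m * (y \<bullet> e)))) \<longlonglongrightarrow> (LINT y|M. 0)"
  proof (rule integral_dominated_convergence)
    show "integrable M (\<lambda>_. \<Sum>e\<in>(Basis::'a set). 2 * (LINT r|lborel. \<bar>vallee_poussin 1 r\<bar>))"
      by simp
    show "AE y in M. norm (\<Sum>e\<in>Basis. vp_modulus (a / 2 ^ m * (y \<bullet> e))) \<le>
      (\<Sum>e\<in>(Basis::'a set). 2 * (LINT r|lborel. \<bar>vallee_poussin 1 r\<bar>))" for m
      by (intro AE_I2 norm_vp_modulus_sum_le)
    show "AE y in M. (\<lambda>m. \<Sum>e\<in>Basis. vp_modulus (a / 2 ^ m * (y \<bullet> e))) \<longlonglongrightarrow> 0"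
    proof (intro AE_I2 tendsto_null_sum vp_modulus_tendsto_0)
      fix y e :: 'a
      have "(\<lambda>m. (a * (y \<bullet> e)) * (1 / 2) ^ m) \<longlonglongrightarrow> (a * (y \<bullet> e)) * 0"
        by (intro tendsto_intros LIMSEQ_realpow_zero) auto
      then show "(\<lambda>m. a / 2 ^ m * (y \<bullet> e)) \<longlonglongrightarrow> 0"
        by (simp add: power_one_over field_simps)
    qed
  qed (auto intro!: borel_probD(4)[OF M])
  then show ?thesis by simp
qed

text \<open>The choices are made in the order \<open>a\<close>, \<kappa>, \<open>m\<close>,
  \<delta>, all before \<phi> is given; this makes \<delta> uniform in \<phi>.\<close>

lemma wiener_lower_bound:
  fixes M :: "'a::euclidean_space measure"
  assumes M: "borel_prob M" and nz: "\<And>t. char_fun M t \<noteq> 0"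
    and L: "0 \<le> L" and B: "0 \<le> B" and \<epsilon>: "0 < \<epsilon>"
  obtains \<delta> where "0 < \<delta>"
    "\<And>\<phi> x D. (\<And>x y. norm (\<phi> x - \<phi> y) \<le> L * dist x y) \<Longrightarrow> (\<And>x. norm (\<phi> x) \<le> B) \<Longrightarrow>
      (\<And>x. norm (average M id (\<lambda>_. 1) \<phi> x) \<le> D) \<Longrightarrow> \<epsilon> \<le> norm (\<phi> x) \<Longrightarrow> \<delta> \<le> D"
proof -
  interpret prob_space M using borel_probD[OF M] by simp
  obtain es :: "'a list" where es: "set es = Basis" "distinct es"
    using finite_distinct_list[OF finite_Basis] by blast
  let ?\<eta> = "\<lambda>a. LINT s|lborel. min (L * (\<bar>s\<bar> / a)) (2 * B) * fejer 1 s"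
  \<comment> \<open>Scale at which smoothing costs at most half of \<epsilon>.\<close>
  obtain a where a: "0 < a" "length es * ?\<eta> a \<le> \<epsilon> / 2"
  proof -
    have "(\<lambda>n. length es * ?\<eta> (real (Suc n))) \<longlonglongrightarrow> 0"
      using tendsto_mult_right_zero[OF fejer_error_tendsto_0[OF L B]] .
    from order_tendstoD(2)[OF this, of "\<epsilon> / 2"] \<epsilon>
    obtain n where "length es * ?\<eta> (real (Suc n)) < \<epsilon> / 2"
      by (auto simp: eventually_sequentially)
    then show ?thesis by (intro that[of "real (Suc n)"]) auto
  qed
  \<comment> \<open>Frequencies with coordinates of size at most \<open>a\<close> lie in the ball of
    radius \<open>DIM('a) * a\<close>.\<close>
  obtain \<kappa> where \<kappa>: "0 < \<kappa>" "\<And>t. norm t \<le> DIM('a) * a \<Longrightarrow> \<kappa> \<le> norm (char_fun M t)"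
    using char_fun_bounded_below[OF M nz] by blast
  \<comment> \<open>Enough halvings for the plane wave error to take up at most half of
    \<kappa>.\<close>
  obtain m where m: "(LINT y|M. (\<Sum>e\<in>Basis. vp_modulus (a / 2 ^ m * (y \<bullet> e)))) \<le> \<kappa> / 2"
    using order_tendstoD(2)[OF vp_modulus_integral_tendsto_0[OF M, of a], of "\<kappa> / 2"] \<kappa>(1)
    by (auto simp: eventually_sequentially intro: less_imp_le)
  define \<delta> where "\<delta> = \<kappa> / 2 * (\<epsilon> / 2 / (2 ^ m) ^ length es)"
  show ?thesis
  proof (rule that)
    show "0 < \<delta>" using \<kappa>(1) \<epsilon> by (simp add: \<delta>_def)
    fix \<phi> :: "'a \<Rightarrow> complex" and x D
    assume lip: "\<And>x y. norm (\<phi> x - \<phi> y) \<le> L * dist x y" and bd: "\<And>x. norm (\<phi> x) \<le> B"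
      and D: "\<And>x. norm (average M id (\<lambda>_. 1) \<phi> x) \<le> D" and x: "\<epsilon> \<le> norm (\<phi> x)"
    have \<phi>: "bounded_continuous \<phi>"
      unfolding bounded_continuous_def
    proof
      have "L-lipschitz_on UNIV \<phi>"
        using lip L by (auto intro!: lipschitz_onI simp: dist_norm)
      then show "continuous_on UNIV \<phi>" by (rule lipschitz_on_continuous_on)
      show "bounded (range \<phi>)" using bd by (auto simp: bounded_iff)
    qed
    have mid: "id \<in> borel_measurable M" by (intro borel_probD(4)[OF M]) measurable
    let ?b = "a / 2 ^ m"
    have b: "0 < ?b" using a by simp
    have "norm (fejer_means es a (\<lambda>_. 0) \<phi> x - \<phi> x) \<le> \<epsilon> / 2"
      using fejer_means_approx[OF a(1) \<phi> bd lip, of es x] es a(2) by simp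
    then have big: "\<epsilon> / 2 \<le> norm (fejer_means es a (\<lambda>_. 0) \<phi> x)"
      using x norm_triangle_ineq3[of "fejer_means es a (\<lambda>_. 0) \<phi> x" "\<phi> x"] by linarith
    obtain t where t: "\<And>e. \<bar>t e\<bar> \<le> a"
      "norm (fejer_means es a (\<lambda>_. 0) \<phi> x) / (2 ^ m) ^ length es \<le> norm (fejer_means es ?b t \<phi> x)"
      using fejer_means_bisection[OF a(1) \<phi> es(2)] by blast
    let ?\<psi> = "fejer_means es ?b t \<phi>" and ?t = "\<Sum>e\<in>Basis. t e *\<^sub>R e"
    have "norm ?t \<le> (\<Sum>e\<in>(Basis::'a set). a)"
      using t(1) by (intro sum_norm_le) simp
    then have \<kappa>t: "\<kappa> \<le> norm (char_fun M ?t)" by (intro \<kappa>(2)) simp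
    \<comment> \<open>The plane wave error is relative to the supremum, which need not be attained
      at \<open>x\<close> or anywhere else; hence the estimate below is proved at every
      point.\<close>
    define S where "S = (SUP y. norm (?\<psi> y))"
    have "norm (?\<psi> y) \<le> B" for y
      by (rule norm_fejer_means_le[OF b \<phi> bd])
    then have S: "norm (?\<psi> y) \<le> S" for y
      unfolding S_def by (intro cSUP_upper bdd_aboveI2[where M=B]) auto
    have S0: "0 \<le> S" using S norm_ge_zero order_trans by blast
    have "norm (?\<psi> y) \<le> (D + S * (\<kappa> / 2)) / \<kappa>" for y
    proof -
      have "norm (average M id (\<lambda>_. 1) ?\<psi> y) \<le> D"
      proof -
        \<comment> \<open>Averaging commutes with the filter, and the filter does not increase the
          bound \<open>D\<close>.\<close>
        have "average M id (\<lambda>_. 1) ?\<psi> = fejer_means es ?b t (average M id (\<lambda>_. 1) \<phi>)"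
          by (rule fejer_means_average_commute[OF \<phi> sigma_finite_measure_axioms mid]) simp
        moreover have "bounded_continuous (average M id (\<lambda>_. 1) \<phi>)"
          by (rule bounded_continuous_average[OF \<phi> mid]) simp
        ultimately show ?thesis using norm_fejer_means_le[OF b _ D] by simp
      qed
      moreover have "norm (average M id (\<lambda>_. 1) ?\<psi> y - char_fun M ?t * ?\<psi> y) \<le> S * (\<kappa> / 2)"
        by (rule order_trans[OF average_by_measure_modulus[OF M b \<phi> S es(1)]])
          (intro mult_left_mono m S0)
      ultimately have "norm (char_fun M ?t * ?\<psi> y) \<le> D + S * (\<kappa> / 2)"
        using norm_triangle_ineq3[of "char_fun M ?t * ?\<psi> y" "average M id (\<lambda>_. 1) ?\<psi> y"]
        by (simp add: norm_minus_commute)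
      moreover have "\<kappa> * norm (?\<psi> y) \<le> norm (char_fun M ?t * ?\<psi> y)"
        unfolding norm_mult by (intro mult_right_mono \<kappa>t) simp
      ultimately show ?thesis using \<kappa>(1) by (simp add: field_simps)
    qed
    \<comment> \<open>Taking the supremum puts \<open>S\<close> on both sides, and its right-hand
      coefficient 1/2 lets it be absorbed.\<close>
    then have "S \<le> (D + S * (\<kappa> / 2)) / \<kappa>"
      unfolding S_def[symmetric] by (subst S_def) (intro cSUP_least, auto)
    then have "S * (\<kappa> / 2) \<le> D" using \<kappa>(1) by (simp add: field_simps)
    moreover have "\<epsilon> / 2 / (2 ^ m) ^ length es \<le> S"
      using divide_right_mono[OF big, of "(2 ^ m) ^ length es"] t(2) S[of x] by simp
    then have "\<delta> \<le> S * (\<kappa> / 2)"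
      unfolding \<delta>_def using \<kappa>(1) by (subst mult.commute, intro mult_right_mono) auto
    ultimately show "\<delta> \<le> D" by linarith
  qed
qed

section \<open>The bounded Lipschitz distance\<close>

lemma bl_dist_upper:
  assumes "borel_prob M" "borel_prob N" "f \<in> bl_unit_ball"
  shows "\<bar>(LINT x|M. f x) - (LINT x|N. f x)\<bar> \<le> bl_dist M N"
  unfolding bl_dist_def by (rule cSUP_upper[OF assms(3) bdd_above_bl_dist[OF assms(1,2)]])

lemma bl_dist_least:
  assumes "\<And>f. f \<in> bl_unit_ball \<Longrightarrow> \<bar>(LINT x|M. f x) - (LINT x|N. f x)\<bar> \<le> D"
  shows "bl_dist M N \<le> D"
  unfolding bl_dist_def using bl_unit_ball_nonempty assms by (rule cSUP_least)

lemma bl_dist_nonneg: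
  assumes "borel_prob M" "borel_prob N"
  shows "0 \<le> bl_dist M N"
  using bl_dist_upper[OF assms] bl_unit_ball_nonempty by (meson abs_ge_zero all_not_in_conv order_trans)

section \<open>Averaged test functions and convolutions\<close>

lemma bl_unit_ball_translate:
  fixes f :: "'a::real_normed_vector \<Rightarrow> real"
  shows "f \<in> bl_unit_ball \<Longrightarrow> (\<lambda>y. f (x + y)) \<in> bl_unit_ball"
  by (auto simp: bl_unit_ball_def lipschitz_on_def) (metis dist_add_cancel)

lemma bl_unit_ball_lipschitz:
  "f \<in> bl_unit_ball \<Longrightarrow> \<bar>f x - f y\<bar> \<le> dist x y"
  by (auto simp: bl_unit_ball_def lipschitz_on_def dist_real_def)

lemma bl_unit_ball_average_lipschitz:
  fixes f :: "'a::euclidean_space \<Rightarrow> real"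
  assumes M: "borel_prob M" and f: "f \<in> bl_unit_ball"
  shows "\<bar>(LINT z|M. f (x + z)) - (LINT z|M. f (y + z))\<bar> \<le> dist x y"
proof -
  interpret prob_space M using borel_probD[OF M] by simp
  have i: "integrable M (\<lambda>z. f (x + z))" for x
    using bl_unit_ball_integral_bound(1)[OF M bl_unit_ball_translate[OF f]] .
  have "\<bar>(LINT z|M. f (x + z)) - (LINT z|M. f (y + z))\<bar> = \<bar>LINT z|M. f (x + z) - f (y + z)\<bar>"
    using i by simp
  also have "\<dots> \<le> (LINT z|M. dist x y)"
  proof (rule order_trans[OF integral_abs_bound], rule integral_mono)
    show "integrable M (\<lambda>z. \<bar>f (x + z) - f (y + z)\<bar>)" using i by simp
    show "\<bar>f (x + z) - f (y + z)\<bar> \<le> dist x y" for z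
      using bl_unit_ball_lipschitz[OF f, of "x + z" "y + z"] by simp
  qed simp
  finally show ?thesis by (simp add: prob_space)
qed

lemma bl_unit_ball_average:
  fixes f :: "'a::euclidean_space \<Rightarrow> real"
  assumes M: "borel_prob M" and f: "f \<in> bl_unit_ball"
  shows "(\<lambda>x. LINT z|M. f (x + z)) \<in> bl_unit_ball"
  using bl_unit_ball_average_lipschitz[OF M f] bl_unit_ball_integral_bound(2)[OF M bl_unit_ball_translate[OF f]]
  by (auto simp: bl_unit_ball_def dist_real_def intro!: lipschitz_onI)

lemma borel_prob_convolution:
  assumes M: "borel_prob M" and N: "borel_prob N"
  shows "borel_prob (convolution M N)"
proof -
  interpret M: prob_space M using borel_probD[OF M] by simp
  interpret N: prob_space N using borel_probD[OF N] by simp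
  interpret pair_prob_space M N ..
  have [measurable_cong]: "sets M = sets borel" "sets N = sets borel"
    using borel_probD M N by blast+
  show ?thesis
    unfolding borel_prob_def convolution_def by (auto intro!: prob_space_distr)
qed

text \<open>Both orders serve: integrating the smoothing measure first gives the contraction
  property, integrating it last exhibits an average against it.\<close>

lemma integral_convolution:
  fixes f :: "'a::ordered_euclidean_space \<Rightarrow> real"
  assumes M: "borel_prob M" and N: "borel_prob N"
    and [measurable]: "f \<in> borel_measurable borel" and f: "\<And>x. \<bar>f x\<bar> \<le> B"
  shows "(LINT x|convolution M N. f x) = (LINT x|M. LINT y|N. f (x + y))"
    and "(LINT x|convolution M N. f x) = (LINT y|N. LINT x|M. f (x + y))"
proof -
  interpret M: prob_space M using borel_probD[OF M] by simp
  interpret N: prob_space N using borel_probD[OF N] by simp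
  interpret P: pair_prob_space M N ..
  have [measurable_cong]: "sets M = sets borel" "sets N = sets borel"
    using borel_probD M N by blast+
  have i: "integrable (M \<Otimes>\<^sub>M N) (\<lambda>(x, y). f (x + y))"
    by (rule P.integrable_const_bound[where B=B]) (use f in auto)
  have "(LINT x|convolution M N. f x) = (LINT p|(M \<Otimes>\<^sub>M N). (case p of (x, y) \<Rightarrow> f (x + y)))"
    unfolding convolution_def by (subst integral_distr) (auto simp: case_prod_unfold)
  then show "(LINT x|convolution M N. f x) = (LINT x|M. LINT y|N. f (x + y))"
    "(LINT x|convolution M N. f x) = (LINT y|N. LINT x|M. f (x + y))"
    using P.integral_fst[OF i] P.integral_snd[OF i] by simp_all
qed

lemma bl_dist_convolution_le:
  fixes M :: "'a::ordered_euclidean_space measure"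
  assumes M: "borel_prob M" and N: "borel_prob N" and X: "borel_prob X"
  shows "bl_dist (convolution M X) (convolution N X) \<le> bl_dist M N"
proof (rule bl_dist_least)
  fix f :: "'a \<Rightarrow> real" assume f: "f \<in> bl_unit_ball"
  then have f1: "\<bar>f x\<bar> \<le> 1" for x by (simp add: bl_unit_ball_def)
  show "\<bar>(LINT x|convolution M X. f x) - (LINT x|convolution N X. f x)\<bar> \<le> bl_dist M N"
    unfolding integral_convolution(1)[OF M X bl_unit_ball_measurable[OF f] f1]
      integral_convolution(1)[OF N X bl_unit_ball_measurable[OF f] f1]
    by (rule bl_dist_upper[OF M N bl_unit_ball_average[OF X f]])
qed

text \<open>The translates of a test function are again test functions, so closeness of the
  convolutions controls the average of \<open>\<phi>\<close> at every point, as the Wiener estimate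
  requires. The \<delta> is uniform over all pairs of measures, which takes the place of
  compactness.\<close>

lemma bl_dist_deconvolution:
  fixes X :: "'a::ordered_euclidean_space measure"
  assumes X: "borel_prob X" and nz: "\<And>t. char_fun X t \<noteq> 0" and \<epsilon>: "0 < \<epsilon>"
  obtains \<delta> where "0 < \<delta>"
    "\<And>M N. borel_prob M \<Longrightarrow> borel_prob N \<Longrightarrow> bl_dist (convolution M X) (convolution N X) < \<delta> \<Longrightarrow> bl_dist M N \<le> \<epsilon>"
proof -
  \<comment> \<open>Both constants are 2, as \<phi> will be a difference of two 1-Lipschitz
    functions bounded by 1.\<close>
  obtain \<delta> where \<delta>: "0 < \<delta>"
    "\<And>(\<phi> :: 'a \<Rightarrow> complex) x D. (\<And>x y. norm (\<phi> x - \<phi> y) \<le> 2 * dist x y) \<Longrightarrow> (\<And>x. norm (\<phi> x) \<le> 2) \<Longrightarrow>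
      (\<And>x. norm (average X id (\<lambda>_. 1) \<phi> x) \<le> D) \<Longrightarrow> \<epsilon> \<le> norm (\<phi> x) \<Longrightarrow> \<delta> \<le> D"
    using wiener_lower_bound[OF X nz, of 2 2 \<epsilon>] \<epsilon> by (metis zero_le_numeral)
  show ?thesis
  proof (rule that[OF \<delta>(1)], rule bl_dist_least)
    fix M N :: "'a measure" and f :: "'a \<Rightarrow> real"
    assume M: "borel_prob M" and N: "borel_prob N" and f: "f \<in> bl_unit_ball"
      and small: "bl_dist (convolution M X) (convolution N X) < \<delta>"
    let ?D = "bl_dist (convolution M X) (convolution N X)"
    define \<phi> where "\<phi> x = (LINT y|M. f (x + y)) - (LINT y|N. f (x + y))" for x
    have lip: "\<bar>\<phi> x - \<phi> y\<bar> \<le> 2 * dist x y" for x y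
      using bl_unit_ball_average_lipschitz[OF M f, of x y] bl_unit_ball_average_lipschitz[OF N f, of x y]
      unfolding \<phi>_def by linarith
    have bd: "\<bar>\<phi> x\<bar> \<le> 2" for x
      using bl_unit_ball_integral_bound(2)[OF M bl_unit_ball_translate[OF f], of x]
        bl_unit_ball_integral_bound(2)[OF N bl_unit_ball_translate[OF f], of x]
      unfolding \<phi>_def by linarith
    have av: "average X id (\<lambda>_. 1) (\<lambda>x. complex_of_real (\<phi> x)) x =
      of_real ((LINT w|convolution M X. f (x + w)) - (LINT w|convolution N X. f (x + w)))" for x
    proof -
      note g = bl_unit_ball_translate[OF f, of x]
      have g1: "\<bar>f (x + w)\<bar> \<le> 1" for w using f by (simp add: bl_unit_ball_def)
      have i: "integrable X (\<lambda>z. LINT y|P. f (x + z + y))" if P: "borel_prob P" for P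
        using bl_unit_ball_integral_bound(1)[OF X bl_unit_ball_translate[OF bl_unit_ball_average[OF P f], of x]]
        by simp
      have conv: "(LINT w|convolution P X. f (x + w)) = (LINT z|X. LINT y|P. f (x + z + y))" if P: "borel_prob P" for P
        using integral_convolution(2)[OF P X bl_unit_ball_measurable[OF g] g1] by (simp add: ac_simps)
      have "average X id (\<lambda>_. 1) (\<lambda>x. complex_of_real (\<phi> x)) x = (CLINT z|X. of_real (\<phi> (x + z)))"
        by (simp add: average_def)
      also have "\<dots> = of_real (LINT z|X. \<phi> (x + z))"
        by (rule integral_complex_of_real)
      also have "(LINT z|X. \<phi> (x + z)) = (LINT w|convolution M X. f (x + w)) - (LINT w|convolution N X. f (x + w))"
        unfolding conv[OF M] conv[OF N] \<phi>_def using i[OF M] i[OF N] by simp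
      finally show ?thesis .
    qed
    have "norm (average X id (\<lambda>_. 1) (\<lambda>x. complex_of_real (\<phi> x)) x) \<le> ?D" for x
      unfolding av norm_of_real
      by (rule bl_dist_upper[OF borel_prob_convolution[OF M X] borel_prob_convolution[OF N X] bl_unit_ball_translate[OF f]])
    \<comment> \<open>Contrapositive of the Wiener estimate at 0, where \<phi> is the difference of
      the integrals of \<open>f\<close>.\<close>
    then have "\<not> \<epsilon> \<le> norm (complex_of_real (\<phi> 0))"
      using \<delta>(2)[of "\<lambda>x. complex_of_real (\<phi> x)" ?D 0] lip bd small
      by (auto simp flip: of_real_diff)
    then show "\<bar>(LINT x|M. f x) - (LINT x|N. f x)\<bar> \<le> \<epsilon>"
      unfolding norm_of_real by (simp add: \<phi>_def)
  qed
qed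

theorem propositionC2:
  fixes \<mu> \<nu> :: "nat \<Rightarrow> (real ^ 'd) measure" and \<xi> :: "(real ^ 'd) measure"
  assumes "\<And>n. borel_prob (\<mu> n)"
    and "\<And>n. borel_prob (\<nu> n)"
    and "borel_prob \<xi>"
    and "\<And>t. char_fun \<xi> t \<noteq> 0"
  shows "((\<lambda>n. bl_dist (convolution (\<mu> n) \<xi>) (convolution (\<nu> n) \<xi>)) \<longlonglongrightarrow> 0)
    \<longleftrightarrow> ((\<lambda>n. bl_dist (\<mu> n) (\<nu> n)) \<longlonglongrightarrow> 0)"
proof
  assume conv: "(\<lambda>n. bl_dist (convolution (\<mu> n) \<xi>) (convolution (\<nu> n) \<xi>)) \<longlonglongrightarrow> 0"
  show "(\<lambda>n. bl_dist (\<mu> n) (\<nu> n)) \<longlonglongrightarrow> 0"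
  proof (rule order_tendstoI)
    fix c :: real assume "c < 0"
    then show "\<forall>\<^sub>F n in sequentially. c < bl_dist (\<mu> n) (\<nu> n)"
      using bl_dist_nonneg[OF assms(1,2)] by (intro always_eventually allI) (rule less_le_trans)
  next
    fix c :: real assume c: "0 < c"
    \<comment> \<open>Deconvolution gives a weak inequality; \<open>c / 2\<close> makes it
      strict.\<close>
    obtain \<delta> where \<delta>: "0 < \<delta>" "\<And>M N. borel_prob M \<Longrightarrow> borel_prob N \<Longrightarrow>
        bl_dist (convolution M \<xi>) (convolution N \<xi>) < \<delta> \<Longrightarrow> bl_dist M N \<le> c / 2"
      using bl_dist_deconvolution[OF assms(3,4), of "c / 2"] c by auto
    from order_tendstoD(2)[OF conv \<delta>(1)]
    show "\<forall>\<^sub>F n in sequentially. bl_dist (\<mu> n) (\<nu> n) < c"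
    proof eventually_elim
      case (elim n)
      from \<delta>(2)[OF assms(1,2) elim] c show ?case by simp
    qed
  qed
next
  assume lim: "(\<lambda>n. bl_dist (\<mu> n) (\<nu> n)) \<longlonglongrightarrow> 0"
  show "(\<lambda>n. bl_dist (convolution (\<mu> n) \<xi>) (convolution (\<nu> n) \<xi>)) \<longlonglongrightarrow> 0"
  proof (rule tendsto_sandwich[OF _ _ tendsto_const lim])
    show "\<forall>\<^sub>F n in sequentially. 0 \<le> bl_dist (convolution (\<mu> n) \<xi>) (convolution (\<nu> n) \<xi>)"
      using assms by (intro always_eventually allI bl_dist_nonneg borel_prob_convolution)
    show "\<forall>\<^sub>F n in sequentially. bl_dist (convolution (\<mu> n) \<xi>) (convolution (\<nu> n) \<xi>) \<le> bl_dist (\<mu> n) (\<nu> n)"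
      using assms by (intro always_eventually allI bl_dist_convolution_le)
  qed
qed

end
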